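(* Let $(A,G)$ be a definitizable pair of selfadjoint operators in $\mathcal H$. Then: (a) $\sigma(AG)\setminus\mathbb R$ consists of finitely many points, each of which is a pole of the resolvent of $AG$ and a zero of every definitizing polynomial for $(A,G)$; (b) if $\lambda\in\sigma(AG)\cap(\mathbb R\setminus\{0\})$ and $p(\lambda)>0$ for some definitizing polynomial $p$ for $(A,G)$, then $\lambda\in\sigma_{++}(AG)$; (c) if $\lambda\in\sigma(AG)\cap(\mathbb R\setminus\{0\})$ and $p(\lambda)<0$ for some definitizing polynomial $p$ for $(A,G)$, then $\lambda\in\sigma_{--}(AG)$.
   Context: $(\mathcal H,(\cdot,\cdot))$ complex Hilbert space; $A,G$ possibly unbounded selfadjoint; $AG,GA$ operator products with natural domains. $\rho(S)$: set of $\lambda$ with $S-\lambda$ injective, surjective, with bounded everywhere defined inverse; $\sigma(S)=\mathbb C\setminus\rho(S)$; $\sigma_{ap}(S)$: set of $\lambda$ with $(x_n)\subset\operatorname{dom}S$, $\|x_n\|=1$, $(S-\lambda)x_n\to0$. Definition: $(A,G)$ is definitizable if $\rho(AG)\neq\emptyset$, $\rho(GA)\neq\emptyset$ and there is a real polynomial $p\neq0$ of degree $d$ with $(p(AG)x,Gx)\ge0$ for all $x\in\operatorname{dom}(AG)^{\max\{1,d\}}$ (a definitizing polynomial). Fix $\lambda_0\in\mathbb C\setminus\mathbb R$ with $\lambda_0,\overline{\lambda_0}\in\rho(AG)$; $G_0:=G(AG-\lambda_0)^{-1}(AG-\overline{\lambda_0})^{-1}$ is bounded selfadjoint, $[x,y]:=(G_0x,y)$.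 $\sigma_{++}(AG)$ ($\sigma_{--}(AG)$) is the set of $\lambda\in\sigma_{ap}(AG)$ such that every $(x_n)\subset\operatorname{dom}(AG)$ with $\|x_n\|=1$, $(AG-\lambda)x_n\to0$ satisfies $\liminf_n[x_n,x_n]>0$ (resp. $\limsup_n[x_n,x_n]<0$); these sets do not depend on $\lambda_0$. *)

theory Defs
  imports "HOL-Analysis.Analysis" "HOL-Computational_Algebra.Polynomial"
begin

class complex_vector = real_vector +
  fixes scaleC :: "complex \<Rightarrow> 'a \<Rightarrow> 'a" (infixr "*\<^sub>C" 75)
  assumes scaleC_add_right: "a *\<^sub>C (x + y) = a *\<^sub>C x + a *\<^sub>C y"
    and scaleC_add_left: "(a + b) *\<^sub>C x = a *\<^sub>C x + b *\<^sub>C x"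
    and scaleC_scaleC: "a *\<^sub>C (b *\<^sub>C x) = (a * b) *\<^sub>C x"
    and scaleC_one: "1 *\<^sub>C x = x"
    and scaleR_scaleC: "scaleR r x = complex_of_real r *\<^sub>C x"

class complex_inner = complex_vector + real_normed_vector +
  fixes cinner :: "'a \<Rightarrow> 'a \<Rightarrow> complex"
  assumes cinner_commute: "cinner x y = cnj (cinner y x)"
    and cinner_add_left: "cinner (x + y) z = cinner x z + cinner y z"
    and cinner_scaleC_left: "cinner (a *\<^sub>C x) y = a * cinner x y"
    and cinner_norm: "cinner x x = complex_of_real ((norm x)\<^sup>2)"

class chilbert_space = complex_inner + complete_space

type_synonym 'a lop = "'a set \<times> ('a \<Rightarrow> 'a)"

definition dom :: "'a lop \<Rightarrow> 'a set" where "dom S = fst S"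
definition app :: "'a lop \<Rightarrow> 'a \<Rightarrow> 'a" where "app S = snd S"

definition linear_op :: "'a::complex_vector lop \<Rightarrow> bool" where
  "linear_op S \<longleftrightarrow> 0 \<in> dom S
     \<and> (\<forall>x\<in>dom S. \<forall>y\<in>dom S. x + y \<in> dom S \<and> app S (x + y) = app S x + app S y)
     \<and> (\<forall>a. \<forall>x\<in>dom S. a *\<^sub>C x \<in> dom S \<and> app S (a *\<^sub>C x) = a *\<^sub>C app S x)"

text \<open>Selfadjointness: S densely defined, dom S* = dom S and S* = S there,
where dom S* = {y. \<exists>z. \<forall>x\<in>dom S. (Sx,y) = (x,z)} and S*y = z.\<close>
definition selfadjoint :: "'a::chilbert_space lop \<Rightarrow> bool" where
  "selfadjoint S \<longleftrightarrow> linear_op S \<and> closure (dom S) = UNIV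
     \<and> (\<forall>y. y \<in> dom S \<longleftrightarrow> (\<exists>z. \<forall>x\<in>dom S. cinner (app S x) y = cinner x z))
     \<and> (\<forall>x\<in>dom S. \<forall>y\<in>dom S. cinner (app S x) y = cinner x (app S y))"

definition op_mult :: "'a lop \<Rightarrow> 'a lop \<Rightarrow> 'a lop" (infixl "\<bullet>\<^sub>o\<^sub>p" 70) where
  "A \<bullet>\<^sub>o\<^sub>p G = ({x \<in> dom G. app G x \<in> dom A}, \<lambda>x. app A (app G x))"

definition op_pow :: "'a lop \<Rightarrow> nat \<Rightarrow> 'a lop" where
  "op_pow S n = ({x. \<forall>k<n. (app S ^^ k) x \<in> dom S}, app S ^^ n)"

text \<open>Real polynomial of an operator, on dom S^(degree p).\<close>
definition poly_op :: "real poly \<Rightarrow> 'a::complex_vector lop \<Rightarrow> 'a \<Rightarrow> 'a" where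
  "poly_op p S x = (\<Sum>i\<le>degree p. complex_of_real (coeff p i) *\<^sub>C (app S ^^ i) x)"

text \<open>The element (S - l)^{-1} y (meaningful when S - l is bijective dom S \<rightarrow> H).\<close>
definition resolvent :: "'a::complex_vector lop \<Rightarrow> complex \<Rightarrow> 'a \<Rightarrow> 'a" where
  "resolvent S l y = (THE x. x \<in> dom S \<and> app S x - l *\<^sub>C x = y)"

definition rho :: "'a::{complex_vector, real_normed_vector} lop \<Rightarrow> complex set" where
  "rho S = {l. inj_on (\<lambda>x. app S x - l *\<^sub>C x) (dom S)
              \<and> (\<lambda>x. app S x - l *\<^sub>C x) ` dom S = UNIV
              \<and> (\<exists>C. \<forall>y. norm (resolvent S l y) \<le> C * norm y)}"

definition spec :: "'a::{complex_vector, real_normed_vector} lop \<Rightarrow> complex set" where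
  "spec S = UNIV - rho S"

definition sigma_ap :: "'a::{complex_vector, real_normed_vector} lop \<Rightarrow> complex set" where
  "sigma_ap S = {l. \<exists>xs. (\<forall>n. xs n \<in> dom S \<and> norm (xs n) = 1)
                        \<and> (\<lambda>n. app S (xs n) - l *\<^sub>C xs n) \<longlonglongrightarrow> 0}"

definition resolvent_pole :: "'a::{complex_vector, real_normed_vector} lop \<Rightarrow> complex \<Rightarrow> bool" where
  "resolvent_pole S l \<longleftrightarrow> l \<in> spec S \<and>
     (\<exists>\<epsilon>>0. \<exists>C. \<exists>n::nat. \<forall>z. 0 < cmod (z - l) \<and> cmod (z - l) < \<epsilon> \<longrightarrow>
        z \<in> rho S \<and> (\<forall>y. norm (resolvent S z y) \<le> C / (cmod (z - l)) ^ n * norm y))"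

definition definitizing :: "'a::chilbert_space lop \<Rightarrow> 'a lop \<Rightarrow> real poly \<Rightarrow> bool" where
  "definitizing A G p \<longleftrightarrow> p \<noteq> 0 \<and>
     (\<forall>x \<in> dom (op_pow (A \<bullet>\<^sub>o\<^sub>p G) (max 1 (degree p))).
        Im (cinner (poly_op p (A \<bullet>\<^sub>o\<^sub>p G) x) (app G x)) = 0 \<and>
        Re (cinner (poly_op p (A \<bullet>\<^sub>o\<^sub>p G) x) (app G x)) \<ge> 0)"

definition definitizable :: "'a::chilbert_space lop \<Rightarrow> 'a lop \<Rightarrow> bool" where
  "definitizable A G \<longleftrightarrow> rho (A \<bullet>\<^sub>o\<^sub>p G) \<noteq> {} \<and> rho (G \<bullet>\<^sub>o\<^sub>p A) \<noteq> {}
     \<and> (\<exists>p. definitizing A G p)"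

definition admissible :: "'a::chilbert_space lop \<Rightarrow> 'a lop \<Rightarrow> complex \<Rightarrow> bool" where
  "admissible A G l0 \<longleftrightarrow> l0 \<notin> \<real> \<and> l0 \<in> rho (A \<bullet>\<^sub>o\<^sub>p G) \<and> cnj l0 \<in> rho (A \<bullet>\<^sub>o\<^sub>p G)"

definition G0 :: "'a::chilbert_space lop \<Rightarrow> 'a lop \<Rightarrow> complex \<Rightarrow> 'a \<Rightarrow> 'a" where
  "G0 A G l0 x = app G (resolvent (A \<bullet>\<^sub>o\<^sub>p G) l0 (resolvent (A \<bullet>\<^sub>o\<^sub>p G) (cnj l0) x))"

text \<open>[x,x] = (G0 x, x) is real (G0 selfadjoint); we use its real part.\<close>
definition sigma_pp :: "'a::chilbert_space lop \<Rightarrow> 'a lop \<Rightarrow> complex \<Rightarrow> complex set" where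
  "sigma_pp A G l0 = {l \<in> sigma_ap (A \<bullet>\<^sub>o\<^sub>p G). \<forall>xs.
      (\<forall>n. xs n \<in> dom (A \<bullet>\<^sub>o\<^sub>p G) \<and> norm (xs n) = 1)
      \<and> (\<lambda>n. app (A \<bullet>\<^sub>o\<^sub>p G) (xs n) - l *\<^sub>C xs n) \<longlonglongrightarrow> 0 \<longrightarrow>
      liminf (\<lambda>n. ereal (Re (cinner (G0 A G l0 (xs n)) (xs n)))) > 0}"

definition sigma_mm :: "'a::chilbert_space lop \<Rightarrow> 'a lop \<Rightarrow> complex \<Rightarrow> complex set" where
  "sigma_mm A G l0 = {l \<in> sigma_ap (A \<bullet>\<^sub>o\<^sub>p G). \<forall>xs.
      (\<forall>n. xs n \<in> dom (A \<bullet>\<^sub>o\<^sub>p G) \<and> norm (xs n) = 1)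
      \<and> (\<lambda>n. app (A \<bullet>\<^sub>o\<^sub>p G) (xs n) - l *\<^sub>C xs n) \<longlonglongrightarrow> 0 \<longrightarrow>
      limsup (\<lambda>n. ereal (Re (cinner (G0 A G l0 (xs n)) (xs n)))) < 0}"

end

theory Submission
  imports Defs
begin

text \<open>
  Let \<open>T = AG\<close> and let \<open>R = (T - \<mu>)\<^sup>-\<^sup>1\<close>, \<open>d = max 1 (deg p)\<close>. The form \<open>(p(T)R\<^sup>dx, GR\<^sup>dw)\<close> is bounded and
  positive semidefinite. If \<open>(T - l)x\<close> is small, then \<open>p(T)R\<^sup>dx \<approx> p(l)R\<^sup>dx\<close>, so the Cauchy-Schwarz inequality
  for the form bounds \<open>|p(l)| \<parallel>GR\<^sup>dx\<parallel>\<close> by the root of \<open>Q x = (p(T)R\<^sup>dx, GR\<^sup>dx)\<close>; as \<open>A(GA - \<nu>)\<^sup>-\<^sup>1\<close> is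
  bounded, this controls \<open>AGR\<^sup>dx \<approx> lR\<^sup>dx\<close> as well. Hence, locally uniformly in \<open>l\<close>,
  \<open>|p(l)| |l| \<parallel>x\<parallel> \<le> C (\<surd>(Q x) + \<parallel>(T - l)x\<parallel>)\<close>.

  For nonreal \<open>l\<close> the symmetry of \<open>T\<close> with respect to \<open>(G\<cdot>,\<cdot>)\<close> gives \<open>Q x = O(\<parallel>(T - l)x\<parallel> \<parallel>x\<parallel>)\<close>, so
  \<open>\<parallel>(T - l)x\<parallel> \<ge> c |p(l)|\<^sup>2 \<parallel>x\<parallel>\<close>. As \<open>\<rho>(T) - {0}\<close> is nonempty, open and symmetric about the real axis, a
  connectedness argument puts every nonreal \<open>l\<close> with \<open>p(l) \<noteq> 0\<close> into \<open>\<rho>(T)\<close>, and the lower bound yields the pole.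
  For real \<open>l\<close> one has \<open>Q x \<approx> p(l) (R\<^sup>dx, GR\<^sup>dx)\<close>, a positive multiple of \<open>p(l) [x,x]\<close> up to a small error, and
  the estimate keeps \<open>Q x\<close> away from \<open>0\<close>.
\<close>

section \<open>Complex inner product spaces\<close>

lemma scaleC_zero_left [simp]: "0 *\<^sub>C (x::'a::complex_vector) = 0"
  using scaleC_add_left[of 0 0 x] by simp

lemma scaleC_zero_right [simp]: "c *\<^sub>C (0::'a::complex_vector) = 0"
  using scaleC_add_right[of c 0 "0::'a"] by simp

lemma scaleC_minus_left: "(- c) *\<^sub>C (x::'a::complex_vector) = - (c *\<^sub>C x)"
  using scaleC_add_left[of c "-c" x] by (simp add: eq_neg_iff_add_eq_0 add.commute)

lemma scaleC_minus_right: "c *\<^sub>C (- x::'a::complex_vector) = - (c *\<^sub>C x)"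
  using scaleC_add_right[of c x "-x"] by (simp add: eq_neg_iff_add_eq_0 add.commute)

lemma scaleC_diff_left: "(a - b) *\<^sub>C (x::'a::complex_vector) = a *\<^sub>C x - b *\<^sub>C x"
  using scaleC_add_left[of a "-b" x] by (simp add: scaleC_minus_left)

lemma scaleC_diff_right: "c *\<^sub>C (x - y::'a::complex_vector) = c *\<^sub>C x - c *\<^sub>C y"
  using scaleC_add_right[of c x "-y"] by (simp add: scaleC_minus_right)

lemma scaleC_sum_right: "c *\<^sub>C sum f I = (\<Sum>i\<in>I. c *\<^sub>C (f i :: 'a::complex_vector))"
  by (induction I rule: infinite_finite_induct) (auto simp: scaleC_add_right)

lemma scaleC_sum_left: "sum f I *\<^sub>C (x::'a::complex_vector) = (\<Sum>i\<in>I. f i *\<^sub>C x)"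
  by (induction I rule: infinite_finite_induct) (auto simp: scaleC_add_left)

lemmas scaleC_simps = scaleC_add_right scaleC_add_left scaleC_diff_left scaleC_diff_right
  scaleC_minus_left scaleC_minus_right scaleC_scaleC scaleC_one

lemma cinner_zero_left [simp]: "cinner (0::'a::complex_inner) y = 0"
  using cinner_add_left[of 0 "0::'a" y] by simp

lemma cinner_minus_left: "cinner (- x::'a::complex_inner) y = - cinner x y"
  using cinner_add_left[of x "-x" y] by (simp add: eq_neg_iff_add_eq_0 add.commute)

lemma cinner_diff_left: "cinner (x - z::'a::complex_inner) y = cinner x y - cinner z y"
  using cinner_add_left[of x "-z" y] by (simp add: cinner_minus_left)

lemma cinner_add_right: "cinner (x::'a::complex_inner) (y + z) = cinner x y + cinner x z"
  by (metis cinner_add_left cinner_commute complex_cnj_add)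

lemma cinner_diff_right: "cinner (x::'a::complex_inner) (y - z) = cinner x y - cinner x z"
  by (metis cinner_diff_left cinner_commute complex_cnj_diff)

lemma cinner_minus_right: "cinner (x::'a::complex_inner) (- y) = - cinner x y"
  by (metis cinner_minus_left cinner_commute complex_cnj_minus)

lemma cinner_scaleC_right: "cinner (x::'a::complex_inner) (c *\<^sub>C y) = cnj c * cinner x y"
  by (metis cinner_scaleC_left cinner_commute complex_cnj_mult)

lemma cinner_zero_right [simp]: "cinner (x::'a::complex_inner) 0 = 0"
  using cinner_diff_right[of x x x] by simp

lemmas cinner_simps = cinner_add_left cinner_add_right cinner_diff_left cinner_diff_right
  cinner_minus_left cinner_minus_right cinner_scaleC_left cinner_scaleC_right

lemma cinner_eq_zeroD: "cinner (x::'a::complex_inner) x = 0 \<Longrightarrow> x = 0"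
  by (simp add: cinner_norm)

lemma norm_scaleC: "norm (c *\<^sub>C (x::'a::complex_inner)) = cmod c * norm x"
proof -
  have "complex_of_real ((norm (c *\<^sub>C x))\<^sup>2) = c * cnj c * complex_of_real ((norm x)\<^sup>2)"
    by (metis cinner_norm cinner_scaleC_left cinner_scaleC_right mult.assoc mult.commute)
  also have "\<dots> = complex_of_real ((cmod c * norm x)\<^sup>2)"
    by (simp add: power_mult_distrib flip: complex_norm_square)
  finally have "(norm (c *\<^sub>C x))\<^sup>2 = (cmod c * norm x)\<^sup>2"
    using of_real_eq_iff by blast
  then show ?thesis
    by (simp add: power2_eq_iff_nonneg)
qed

text \<open>Nonnegativity on the diagonal includes realness, which forces a sesquilinear form to be
  Hermitian (polarization).\<close>
lemma sesquilinear_Cauchy_Schwarz: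
  fixes B :: "'a::complex_vector \<Rightarrow> 'a \<Rightarrow> complex"
  assumes add_left: "\<And>x y z. B (x + y) z = B x z + B y z"
    and add_right: "\<And>x y z. B x (y + z) = B x y + B x z"
    and scale_left: "\<And>c x y. B (c *\<^sub>C x) y = c * B x y"
    and scale_right: "\<And>c x y. B x (c *\<^sub>C y) = cnj c * B x y"
    and real: "\<And>x. Im (B x x) = 0"
    and nonneg: "\<And>x. 0 \<le> Re (B x x)"
  shows "(cmod (B x y))\<^sup>2 \<le> Re (B x x) * Re (B y y)"
proof -
  have expand: "B (x + c *\<^sub>C y) (x + c *\<^sub>C y) = B x x + cnj c * B x y + c * B y x + c * cnj c * B y y" for c
    by (simp add: add_left add_right scale_left scale_right algebra_simps)
  \<comment> \<open>Realness of the diagonal at \<open>x + y\<close> determines the imaginary part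
    of \<open>B y x\<close>; at \<open>x + \<i> y\<close> it determines the real part.\<close>
  have "Im (B y x) = - Im (B x y)"
    using real[of "x + 1 *\<^sub>C y"] real[of x] real[of y] by (simp add: expand)
  moreover have "Re (B y x) = Re (B x y)"
    using real[of "x + \<i> *\<^sub>C y"] real[of x] real[of y] by (simp add: expand)
  ultimately have herm: "B y x = cnj (B x y)"
    by (simp add: complex_eq_iff)
  define b where "b = (cmod (B x y))\<^sup>2"
  have b: "b = (Re (B x y))\<^sup>2 + (Im (B x y))\<^sup>2"
    by (simp add: b_def cmod_power2)
  \<comment> \<open>With real \<open>t\<close>, the choice \<open>c = - t * B x y\<close> makes each
    of the two cross terms equal to \<open>- t * b\<close>.\<close>
  have quad: "0 \<le> Re (B x x) - 2 * t * b + t\<^sup>2 * b * Re (B y y)" for t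
  proof -
    let ?c = "- complex_of_real t * B x y"
    have "Re (B (x + ?c *\<^sub>C y) (x + ?c *\<^sub>C y))
        = Re (B x x) - 2 * t * b + t\<^sup>2 * b * Re (B y y)"
      unfolding expand herm b
      by (simp add: power2_eq_square algebra_simps real)
    then show ?thesis
      using nonneg[of "x + ?c *\<^sub>C y"] by simp
  qed
  have b0: "0 \<le> b" by (simp add: b_def)
  have "b \<le> Re (B x x) * Re (B y y)"
  proof (cases "Re (B y y) = 0")
    case True
    \<comment> \<open>When \<open>B y y\<close> vanishes the quadratic is affine in
      \<open>t\<close>; for \<open>b \<noteq> 0\<close> the chosen \<open>t\<close> would give it
      the value \<open>-1\<close>.\<close>
    have "b = 0"
    proof (rule ccontr)
      assume "b \<noteq> 0"
      with quad[of "(Re (B x x) + 1) / (2 * b)"] True show False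
        by simp
    qed
    then show ?thesis using True by simp
  next
    case False
    then have pos: "Re (B y y) > 0" using nonneg[of y] by linarith
    \<comment> \<open>The quadratic is evaluated at its minimizer
      \<open>t = 1 / Re (B y y)\<close>.\<close>
    then have "0 \<le> Re (B x x) - b / Re (B y y)"
      using quad[of "1 / Re (B y y)"] by (simp add: power2_eq_square field_simps)
    then show ?thesis using pos by (simp add: field_simps)
  qed
  then show ?thesis by (simp add: b_def)
qed

lemma cinner_Cauchy_Schwarz: "cmod (cinner x (y::'a::complex_inner)) \<le> norm x * norm y"
proof -
  have "(cmod (cinner x y))\<^sup>2 \<le> Re (cinner x x) * Re (cinner y y)"
    by (rule sesquilinear_Cauchy_Schwarz) (auto simp: cinner_simps cinner_norm simp del: of_real_power)
  also have "\<dots> = (norm x * norm y)\<^sup>2"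
    by (simp add: cinner_norm power_mult_distrib del: of_real_power)
  finally show ?thesis
    by (rule power2_le_imp_le) simp
qed

lemma norm_add_square:
  "(norm (x + y::'a::complex_inner))\<^sup>2 = (norm x)\<^sup>2 + (norm y)\<^sup>2 + 2 * Re (cinner x y)"
proof -
  have "(norm (x + y))\<^sup>2 = Re (cinner (x + y) (x + y))"
    by (simp add: cinner_norm del: of_real_power)
  also have "\<dots> = Re (cinner x x) + Re (cinner y y) + (Re (cinner x y) + Re (cinner y x))"
    by (simp add: cinner_simps)
  also have "Re (cinner y x) = Re (cinner x y)"
    by (subst cinner_commute) simp
  finally show ?thesis
    by (simp add: cinner_norm del: of_real_power)
qed

lemma norm_diff_square:
  "(norm (x - y::'a::complex_inner))\<^sup>2 = (norm x)\<^sup>2 + (norm y)\<^sup>2 - 2 * Re (cinner x y)"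
  using norm_add_square[of x "(-1) *\<^sub>C y"]
  by (simp add: scaleC_simps cinner_simps)

lemma bounded_bilinear_cinner: "bounded_bilinear (cinner :: 'a::complex_inner \<Rightarrow> 'a \<Rightarrow> complex)"
proof
  show "\<exists>K. \<forall>a b :: 'a. cmod (cinner a b) \<le> norm a * norm b * K"
    using cinner_Cauchy_Schwarz by (metis mult.right_neutral)
qed (auto simp: cinner_simps scaleR_scaleC scaleR_conv_of_real)

lemmas tendsto_cinner = bounded_bilinear.tendsto[OF bounded_bilinear_cinner]

text \<open>Approximating \<open>u\<close> from the dense set makes \<open>u\<close> itself
  available as a test vector, and then \<open>(norm u)\<^sup>2 \<le> c * norm u\<close>. Unbounded
  operators can thus be estimated by testing on a domain only.\<close>

lemma norm_le_if_cinner_le_dense: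
  fixes u :: "'a::complex_inner"
  assumes "closure D = UNIV" and "0 \<le> c" and le: "\<And>z. z \<in> D \<Longrightarrow> cmod (cinner u z) \<le> c * norm z"
  shows "norm u \<le> c"
proof -
  have "u \<in> closure D" using assms by simp
  then obtain z where z: "\<And>n::nat. z n \<in> D" "z \<longlonglongrightarrow> u"
    unfolding closure_sequential by blast
  have "(\<lambda>n. cmod (cinner u (z n))) \<longlonglongrightarrow> cmod (cinner u u)"
    by (intro tendsto_intros tendsto_cinner z)
  moreover have "(\<lambda>n. c * norm (z n)) \<longlonglongrightarrow> c * norm u"
    by (intro tendsto_intros z)
  ultimately have le_u: "cmod (cinner u u) \<le> c * norm u"
    by (rule LIMSEQ_le) (use le z in auto)
  then show ?thesis
    using \<open>0 \<le> c\<close> by (cases "u = 0") (auto simp: cinner_norm power2_eq_square norm_mult)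
qed

text \<open>The representing vector minimizes \<open>J x = \<parallel>x\<parallel>\<^sup>2 - 2 Re (\<phi> x)\<close>; minimizing sequences are Cauchy by
  the parallelogram identity.\<close>
lemma Riesz_representation:
  fixes \<phi> :: "'a::chilbert_space \<Rightarrow> complex"
  assumes add: "\<And>x y. \<phi> (x + y) = \<phi> x + \<phi> y"
    and scale: "\<And>c x. \<phi> (c *\<^sub>C x) = c * \<phi> x"
    and bound: "\<And>x. cmod (\<phi> x) \<le> K * norm x"
  obtains z where "\<And>x. \<phi> x = cinner x z"
proof -
  define J where "J x = (norm x)\<^sup>2 - 2 * Re (\<phi> x)" for x
  have lower: "- K\<^sup>2 \<le> J x" for x
  proof -
    have "Re (\<phi> x) \<le> K * norm x"
      using bound complex_Re_le_cmod order_trans by blast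
    moreover have "0 \<le> (norm x - K)\<^sup>2" by simp
    ultimately show ?thesis
      unfolding J_def power2_diff by (simp add: algebra_simps)
  qed
  define m where "m = Inf (range J)"
  have bdd: "bdd_below (range J)"
    using lower by (auto simp: bdd_below_def)
  have m_le: "m \<le> J x" for x
    unfolding m_def using bdd by (simp add: cInf_lower)
  have "\<exists>x. J x < m + 1 / Suc n" for n :: nat
    using cInf_lessD[of "range J" "m + 1 / Suc n"] by (auto simp: m_def)
  then obtain X where X: "\<And>n::nat. J (X n) < m + 1 / Suc n" by metis
  have half: "\<phi> ((1/2) *\<^sub>C (x + y)) = (\<phi> x + \<phi> y) / 2" for x y
    by (simp add: scale add)
  \<comment> \<open>The linear parts of \<open>J\<close> cancel in the parallelogram identity,
    because \<open>\<phi>\<close> at the midpoint is the mean of its values.\<close>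
  have par: "(norm (x - y))\<^sup>2 = 2 * J x + 2 * J y - 4 * J ((1/2) *\<^sub>C (x + y))" for x y
    using norm_add_square[of x y] norm_diff_square[of x y]
    by (simp add: J_def half norm_scaleC norm_divide power_mult_distrib power_divide field_simps)
  have "Cauchy X"
  proof (rule metric_CauchyI)
    fix e :: real assume e: "0 < e"
    obtain N :: nat where N: "4 / e\<^sup>2 < N" using reals_Archimedean2 by blast
    have "dist (X i) (X j) < e" if "N \<le> i" "N \<le> j" for i j
    proof -
      have *: "J (X i) < m + 1 / Suc N" if "N \<le> i" for i
      proof -
        have "1 / real (Suc i) \<le> 1 / real (Suc N)"
          using that by (intro divide_left_mono) auto
        then show ?thesis using X[of i] by linarith
      qed
      have "(norm (X i - X j))\<^sup>2 < 4 * (1 / Suc N)"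
        using *[OF that(1)] *[OF that(2)] m_le[of "(1/2) *\<^sub>C (X i + X j)"] by (simp add: par)
      also have "\<dots> \<le> e\<^sup>2"
        using N e by (simp add: field_simps) (smt (verit) zero_le_power2)
      finally show ?thesis
        using e by (simp add: dist_norm power2_less_imp_less)
    qed
    then show "\<exists>M. \<forall>i\<ge>M. \<forall>j\<ge>M. dist (X i) (X j) < e" by blast
  qed
  then obtain z where z: "X \<longlonglongrightarrow> z"
    using Cauchy_convergent convergent_def by blast
  have diff: "\<phi> (x - y) = \<phi> x - \<phi> y" for x y
    using add[of "x - y" y] by simp
  have "(\<lambda>n. \<phi> (X n) - \<phi> z) \<longlonglongrightarrow> 0"
  proof (rule Lim_null_comparison)
    show "\<forall>\<^sub>F n in sequentially. norm (\<phi> (X n) - \<phi> z) \<le> K * norm (X n - z)"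
      using bound by (auto simp flip: diff)
    show "(\<lambda>n. K * norm (X n - z)) \<longlonglongrightarrow> 0"
      using z by (intro tendsto_mult_right_zero tendsto_norm_zero) (simp add: LIM_zero_iff)
  qed
  then have "(\<lambda>n. \<phi> (X n)) \<longlonglongrightarrow> \<phi> z" by (simp add: LIM_zero_iff)
  then have "(\<lambda>n. J (X n)) \<longlonglongrightarrow> J z"
    unfolding J_def by (intro tendsto_intros z)
  moreover have "(\<lambda>n. m + 1 / Suc n) \<longlonglongrightarrow> m + 0"
    by (intro tendsto_intros LIMSEQ_Suc lim_1_over_n)
  ultimately have "J z \<le> m + 0"
    by (rule LIMSEQ_le) (use X less_imp_le in blast)
  then have min: "J z \<le> J x" for x using m_le[of x] by linarith
  have Re_eq: "Re (\<phi> x) = Re (cinner x z)" for x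
  proof -
    \<comment> \<open>\<open>2 * a\<close> is the derivative of \<open>J (z + t x)\<close> at
      \<open>t = 0\<close>, which vanishes at the minimizer; the value
      \<open>t = - a / (norm x)\<^sup>2\<close> below makes this explicit.\<close>
    define a where "a = Re (cinner z x) - Re (\<phi> x)"
    have quad: "0 \<le> t\<^sup>2 * (norm x)\<^sup>2 + 2 * t * a" for t :: real
      using min[of "z + complex_of_real t *\<^sub>C x"] norm_add_square[of z "complex_of_real t *\<^sub>C x"]
      by (simp add: J_def a_def add scale norm_scaleC cinner_simps power_mult_distrib algebra_simps)
    have "a = 0"
    proof (cases "x = 0")
      case True
      then show ?thesis using scale[of 0 x] by (simp add: a_def)
    next
      case False
      have "0 \<le> - a\<^sup>2 / (norm x)\<^sup>2"
        using quad[of "- a / (norm x)\<^sup>2"] False by (simp add: power2_eq_square field_simps)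
      then show ?thesis using False by (simp add: divide_le_0_iff)
    qed
    then show ?thesis
      by (subst cinner_commute) (simp add: a_def)
  qed
  have "\<phi> x = cinner x z" for x
  proof -
    \<comment> \<open>Replacing \<open>x\<close> by \<open>\<i> x\<close> turns real parts into
      imaginary parts up to sign.\<close>
    have "Im (\<phi> x) = Im (cinner x z)"
      using Re_eq[of "\<i> *\<^sub>C x"] by (simp add: scale cinner_simps)
    then show ?thesis using Re_eq[of x] by (simp add: complex_eq_iff)
  qed
  then show ?thesis by (rule that)
qed

section \<open>Linear operators and their resolvents\<close>

text \<open>\<open>bounded_linear\<close> refers to real scalars, so complex homogeneity is a
  separate clause.\<close>

definition bounded_clinear :: "('a::complex_inner \<Rightarrow> 'a) \<Rightarrow> bool" where
  "bounded_clinear f \<longleftrightarrow> bounded_linear f \<and> (\<forall>c x. f (c *\<^sub>C x) = c *\<^sub>C f x)"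

lemma bounded_clinearI:
  fixes f :: "'a::complex_inner \<Rightarrow> 'a"
  assumes add: "\<And>x y. f (x + y) = f x + f y"
    and scale: "\<And>c x. f (c *\<^sub>C x) = c *\<^sub>C f x"
    and bound: "\<And>x. norm (f x) \<le> K * norm x"
  shows "bounded_clinear f"
proof -
  have "bounded_linear f"
  proof (rule bounded_linear_intro)
    show "norm (f x) \<le> norm x * K" for x using bound[of x] by (simp add: mult.commute)
  qed (simp_all add: add scale scaleR_scaleC)
  then show ?thesis
    using scale by (simp add: bounded_clinear_def)
qed

lemma bounded_clinear_linear: "bounded_clinear f \<Longrightarrow> linear f"
  by (simp add: bounded_clinear_def bounded_linear.linear)

lemma bounded_clinear_add: "bounded_clinear f \<Longrightarrow> f (x + y) = f x + f y"
  by (simp add: bounded_clinear_linear linear_add)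

lemma bounded_clinear_diff: "bounded_clinear f \<Longrightarrow> f (x - y) = f x - f y"
  by (simp add: bounded_clinear_linear linear_diff)

lemma bounded_clinear_scaleC: "bounded_clinear f \<Longrightarrow> f (c *\<^sub>C x) = c *\<^sub>C f x"
  by (simp add: bounded_clinear_def)

lemma bounded_clinear_bound:
  assumes "bounded_clinear f"
  obtains K where "K > 0" "\<And>x. norm (f x) \<le> K * norm x"
proof -
  have "\<exists>K>0. \<forall>x. norm (f x) \<le> norm x * K"
    using assms by (simp add: bounded_clinear_def bounded_linear.pos_bounded)
  then show ?thesis
    using that by (auto simp: mult.commute)
qed

lemma bounded_clinear_compose:
  "bounded_clinear f \<Longrightarrow> bounded_clinear g \<Longrightarrow> bounded_clinear (\<lambda>x. f (g x))"
  unfolding bounded_clinear_def using bounded_linear_compose[of f g] by simp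

lemma bounded_clinear_ident: "bounded_clinear (\<lambda>x. x)"
  by (simp add: bounded_clinear_def)

lemma bounded_clinear_plus:
  "bounded_clinear f \<Longrightarrow> bounded_clinear g \<Longrightarrow> bounded_clinear (\<lambda>x. f x + g x)"
  by (simp add: bounded_clinear_def bounded_linear_add scaleC_simps)

lemma bounded_clinear_scaled: "bounded_clinear f \<Longrightarrow> bounded_clinear (\<lambda>x. c *\<^sub>C f x)"
proof -
  assume f: "bounded_clinear f"
  then obtain K where K: "\<And>x. norm (f x) \<le> K * norm x"
    using bounded_clinear_bound by blast
  show ?thesis
  proof (rule bounded_clinearI)
    fix x
    show "norm (c *\<^sub>C f x) \<le> (cmod c * K) * norm x"
      using mult_left_mono[OF K, of "cmod c"] by (simp add: norm_scaleC mult.assoc)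
  qed (use f in \<open>simp_all add: bounded_clinear_add bounded_clinear_scaleC scaleC_simps mult.commute\<close>)
qed

lemma bounded_clinear_sum:
  "(\<And>i. i \<in> I \<Longrightarrow> bounded_clinear (f i)) \<Longrightarrow> bounded_clinear (\<lambda>x. \<Sum>i\<in>I. f i x)"
  by (simp add: bounded_clinear_def bounded_linear_sum scaleC_sum_right)

lemma bounded_clinear_funpow: "bounded_clinear f \<Longrightarrow> bounded_clinear (f ^^ n)"
proof (induction n)
  case 0
  then show ?case by (simp add: bounded_clinear_ident id_def)
next
  case (Suc n)
  then show ?case using bounded_clinear_compose[of f "f ^^ n"] by (simp add: comp_def)
qed

text \<open>For each \<open>y\<close> the functional \<open>x \<mapsto> (f x, y)\<close> is
  represented by a vector \<open>g y\<close>. The adjoint relation and the norm bound are what the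
  inversion of \<open>GA - cnj l\<close> below relies on.\<close>

lemma bounded_clinear_adjoint:
  fixes f :: "'a::chilbert_space \<Rightarrow> 'a"
  assumes "bounded_clinear f"
  shows "\<exists>g. (\<forall>x y. cinner (f x) y = cinner x (g y)) \<and> (\<exists>K>0. \<forall>y. norm (g y) \<le> K * norm y)"
proof -
  obtain K where K: "K > 0" "\<And>x. norm (f x) \<le> K * norm x"
    using assms bounded_clinear_bound by blast
  have le: "cmod (cinner (f x) y) \<le> K * norm y * norm x" for x y
  proof -
    have "cmod (cinner (f x) y) \<le> norm (f x) * norm y"
      by (rule cinner_Cauchy_Schwarz)
    also have "\<dots> \<le> K * norm x * norm y"
      by (intro mult_right_mono K) auto
    finally show ?thesis
      by (simp add: mult_ac)
  qed
  have "\<exists>z. \<forall>x. cinner (f x) y = cinner x z" for y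
  proof (rule Riesz_representation[of "\<lambda>x. cinner (f x) y" "K * norm y"])
    show "cmod (cinner (f x) y) \<le> K * norm y * norm x" for x by (rule le)
  qed (use assms in \<open>auto simp: cinner_simps bounded_clinear_add bounded_clinear_scaleC\<close>)
  then obtain g where g: "\<And>x y. cinner (f x) y = cinner x (g y)" by metis
  have "norm (g y) \<le> K * norm y" for y
  proof (rule norm_le_if_cinner_le_dense[of UNIV])
    show "cmod (cinner (g y) z) \<le> K * norm y * norm z" for z
      using le[of z y] by (subst cinner_commute) (simp add: g)
  qed (use K in auto)
  then show ?thesis using g K(1) by blast
qed

lemma dom_op_mult: "x \<in> dom (A \<bullet>\<^sub>o\<^sub>p G) \<longleftrightarrow> x \<in> dom G \<and> app G x \<in> dom A"
  by (auto simp: op_mult_def dom_def)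

lemma app_op_mult: "app (A \<bullet>\<^sub>o\<^sub>p G) x = app A (app G x)"
  by (simp add: op_mult_def app_def)

context
  fixes S :: "'a::complex_vector lop"
  assumes lin: "linear_op S"
begin

lemma linear_op_add:
  "x \<in> dom S \<Longrightarrow> y \<in> dom S \<Longrightarrow> x + y \<in> dom S"
  "x \<in> dom S \<Longrightarrow> y \<in> dom S \<Longrightarrow> app S (x + y) = app S x + app S y"
  using lin unfolding linear_op_def by blast+

lemma linear_op_scaleC:
  "x \<in> dom S \<Longrightarrow> c *\<^sub>C x \<in> dom S"
  "x \<in> dom S \<Longrightarrow> app S (c *\<^sub>C x) = c *\<^sub>C app S x"
  using lin unfolding linear_op_def by blast+

lemma linear_op_diff:
  assumes "x \<in> dom S" "y \<in> dom S"
  shows "x - y \<in> dom S" "app S (x - y) = app S x - app S y"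
  using linear_op_add[of x "(-1) *\<^sub>C y"] linear_op_scaleC[of y "-1"] assms
  by (simp_all add: scaleC_simps)

lemma linear_op_zero: "0 \<in> dom S" "app S 0 = 0"
  using lin linear_op_diff[of 0 0] by (simp_all add: linear_op_def)

end

lemma linear_op_mult: "linear_op A \<Longrightarrow> linear_op G \<Longrightarrow> linear_op (A \<bullet>\<^sub>o\<^sub>p G)"
  unfolding linear_op_def[of "A \<bullet>\<^sub>o\<^sub>p G"]
  by (auto simp: dom_op_mult app_op_mult linear_op_zero linear_op_add linear_op_scaleC)

lemma
  fixes S :: "'a::complex_inner lop"
  assumes l: "l \<in> rho S"
  shows resolvent_in_dom: "resolvent S l y \<in> dom S"
    and app_resolvent: "app S (resolvent S l y) = y + l *\<^sub>C resolvent S l y"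
    and resolvent_app: "x \<in> dom S \<Longrightarrow> resolvent S l (app S x - l *\<^sub>C x) = x"
proof -
  have inj: "inj_on (\<lambda>x. app S x - l *\<^sub>C x) (dom S)"
    and surj: "(\<lambda>x. app S x - l *\<^sub>C x) ` dom S = UNIV"
    using l by (auto simp: rho_def)
  show eq: "resolvent S l (app S x - l *\<^sub>C x) = x" if "x \<in> dom S" for x
    unfolding resolvent_def using inj that by (auto simp: inj_on_def)
  have "\<exists>x\<in>dom S. app S x - l *\<^sub>C x = y"
    using surj by (metis (mono_tags, lifting) UNIV_I imageE)
  then obtain x where "x \<in> dom S" "app S x - l *\<^sub>C x = y"
    by blast
  with eq show "resolvent S l y \<in> dom S" "app S (resolvent S l y) = y + l *\<^sub>C resolvent S l y"
    by (metis, metis diff_add_cancel)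
qed

lemma bounded_clinear_resolvent:
  fixes S :: "'a::complex_inner lop"
  assumes lin: "linear_op S" and l: "l \<in> rho S"
  shows "bounded_clinear (resolvent S l)"
proof -
  let ?R = "resolvent S l"
  note [simp] = resolvent_in_dom[OF l] app_resolvent[OF l]
  obtain K where K: "\<And>y. norm (?R y) \<le> K * norm y"
    using l by (auto simp: rho_def)
  show ?thesis
  proof (rule bounded_clinearI[OF _ _ K])
    show "?R (x + y) = ?R x + ?R y" for x y
      using resolvent_app[OF l, of "?R x + ?R y"]
      by (simp add: linear_op_add[OF lin] scaleC_simps algebra_simps)
    show "?R (c *\<^sub>C x) = c *\<^sub>C ?R x" for c x
      using resolvent_app[OF l, of "c *\<^sub>C ?R x"]
      by (simp add: linear_op_scaleC[OF lin] scaleC_simps algebra_simps)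
  qed
qed

text \<open>The lower bound yields both injectivity and the norm bound \<open>1 / c\<close> for the
  inverse.\<close>

lemma rho_if_bounded_below:
  fixes S :: "'a::complex_inner lop"
  assumes lin: "linear_op S" and c: "c > 0"
    and lower: "\<And>x. x \<in> dom S \<Longrightarrow> c * norm x \<le> norm (app S x - l *\<^sub>C x)"
    and surj: "\<And>y. \<exists>x\<in>dom S. app S x - l *\<^sub>C x = y"
  shows "l \<in> rho S"
proof -
  have inj: "inj_on (\<lambda>x. app S x - l *\<^sub>C x) (dom S)"
  proof (rule inj_onI)
    fix x y assume *: "x \<in> dom S" "y \<in> dom S" "app S x - l *\<^sub>C x = app S y - l *\<^sub>C y"
    then have "app S (x - y) - l *\<^sub>C (x - y) = 0"
      by (simp add: linear_op_diff[OF lin] scaleC_simps algebra_simps)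
    with lower[of "x - y"] * have "c * norm (x - y) \<le> 0"
      by (simp add: linear_op_diff[OF lin])
    with c show "x = y" by (simp add: mult_le_0_iff)
  qed
  have res: "resolvent S l (app S x - l *\<^sub>C x) = x" if "x \<in> dom S" for x
    unfolding resolvent_def using inj that by (auto simp: inj_on_def)
  have "norm (resolvent S l y) \<le> (1 / c) * norm y" for y
  proof -
    obtain x where "x \<in> dom S" "app S x - l *\<^sub>C x = y" using surj by blast
    then show ?thesis using lower[of x] res[of x] c by (auto simp: field_simps)
  qed
  then show ?thesis
    using inj surj unfolding rho_def image_def by (auto intro!: exI[of _ "1 / c"]) metis
qed

text \<open>The vector \<open>x - f ((S - l) x)\<close> lies in the kernel of \<open>S - l\<close>,
  hence is zero, so the right inverse is also a left inverse.\<close>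

lemma rho_if_right_inverse:
  fixes S :: "'a::complex_inner lop"
  assumes lin: "linear_op S" and K: "K > 0"
    and inv: "\<And>y. f y \<in> dom S" "\<And>y. app S (f y) - l *\<^sub>C f y = y"
    and bound: "\<And>y. norm (f y) \<le> K * norm y"
    and ker: "\<And>x. x \<in> dom S \<Longrightarrow> app S x = l *\<^sub>C x \<Longrightarrow> x = 0"
  shows "l \<in> rho S"
proof (rule rho_if_bounded_below[OF lin])
  fix x assume x: "x \<in> dom S"
  let ?y = "app S x - l *\<^sub>C x"
  have "app S (x - f ?y) = l *\<^sub>C (x - f ?y)"
    using inv(2)[of ?y] by (simp add: linear_op_diff[OF lin x inv(1)] scaleC_simps algebra_simps)
  then have "x - f ?y = 0"
    by (intro ker linear_op_diff[OF lin x inv(1)])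
  then have "norm x \<le> K * norm ?y"
    using bound[of ?y] by simp
  then show "1 / K * norm x \<le> norm ?y"
    using K by (simp add: field_simps)
qed (use K inv in auto)

lemma norm_resolvent_le:
  fixes S :: "'a::complex_inner lop"
  assumes l: "l \<in> rho S" and c: "c > 0"
    and lower: "\<And>x. x \<in> dom S \<Longrightarrow> c * norm x \<le> norm (app S x - l *\<^sub>C x)"
  shows "norm (resolvent S l y) \<le> 1 / c * norm y"
  using lower[OF resolvent_in_dom[OF l, of y]] c
  by (simp add: app_resolvent[OF l] field_simps)

text \<open>Neumann series argument for \<open>S - l = (1 - (l - m) R) (S - m)\<close>. The lower
  bound comes from \<open>x = R ((S - l) x) + (l - m) R x\<close>, surjectivity from a
  contraction.\<close>

lemma rho_perturbation:
  fixes S :: "'a::chilbert_space lop"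
  assumes lin: "linear_op S" and m: "m \<in> rho S" and K: "K > 0"
    and bound: "\<And>y. norm (resolvent S m y) \<le> K * norm y"
    and near: "cmod (l - m) * K < 1"
  shows "l \<in> rho S"
proof -
  let ?R = "resolvent S m"
  note R = bounded_clinear_resolvent[OF lin m]
  have small: "norm ((l - m) *\<^sub>C ?R u) \<le> cmod (l - m) * K * norm u" for u
    using mult_left_mono[OF bound, of "cmod (l - m)" u] by (simp add: norm_scaleC mult.assoc)
  show ?thesis
  proof (rule rho_if_bounded_below[OF lin])
    show "(1 - cmod (l - m) * K) / K > 0" using K near by simp
  next
    fix x assume x: "x \<in> dom S"
    let ?h = "app S x - l *\<^sub>C x"
    have "?R (?h + (l - m) *\<^sub>C x) = x"
      using resolvent_app[OF m x] by (simp add: scaleC_simps)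
    then have "x = ?R ?h + (l - m) *\<^sub>C ?R x"
      by (simp add: bounded_clinear_add[OF R] bounded_clinear_scaleC[OF R])
    then have "norm x \<le> norm (?R ?h) + norm ((l - m) *\<^sub>C ?R x)"
      by (metis norm_triangle_ineq)
    also have "\<dots> \<le> K * norm ?h + cmod (l - m) * K * norm x"
      by (intro add_mono bound small)
    finally show "(1 - cmod (l - m) * K) / K * norm x \<le> norm ?h"
      using K by (simp add: field_simps)
  next
    fix y
    \<comment> \<open>A fixed point \<open>u\<close> solves \<open>(1 - (l - m) R) u = y\<close>,
      and then \<open>R u\<close> is a preimage of \<open>y\<close> under
      \<open>S - l\<close>.\<close>
    let ?f = "\<lambda>u. y + (l - m) *\<^sub>C ?R u"
    have "\<exists>!u. ?f u = u"
    proof (rule banach_fix_type)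
      show "0 \<le> cmod (l - m) * K" using K by simp
      show "\<forall>u v. dist (?f u) (?f v) \<le> cmod (l - m) * K * dist u v"
        using small by (simp add: dist_norm flip: scaleC_diff_right bounded_clinear_diff[OF R])
    qed (rule near)
    then obtain u where u: "y + (l - m) *\<^sub>C ?R u = u" by blast
    have "app S (?R u) - l *\<^sub>C ?R u = y"
      using u by (simp add: app_resolvent[OF m] scaleC_simps algebra_simps)
    then show "\<exists>x\<in>dom S. app S x - l *\<^sub>C x = y"
      using resolvent_in_dom[OF m] by blast
  qed
qed

lemma open_rho:
  fixes S :: "'a::chilbert_space lop"
  assumes lin: "linear_op S"
  shows "open (rho S)"
proof (rule openI)
  fix m assume m: "m \<in> rho S"
  obtain K where K: "K > 0" "\<And>y. norm (resolvent S m y) \<le> K * norm y"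
    using bounded_clinear_bound[OF bounded_clinear_resolvent[OF lin m]] by blast
  have "l \<in> rho S" if "l \<in> ball m (1 / K)" for l
    using rho_perturbation[OF lin m K(1) K(2), of l] that K(1)
    by (simp add: dist_norm norm_minus_commute field_simps)
  then show "\<exists>e>0. ball m e \<subseteq> rho S"
    using K(1) by (intro exI[of _ "1 / K"]) auto
qed

text \<open>The lower bound \<open>c\<close> at \<open>l\<close> leaves \<open>c / 2\<close> at
  \<open>m\<close>, so the resolvent at \<open>m\<close> has norm at most \<open>2 / c\<close> and
  the perturbation reaches back to \<open>l\<close>. In other words, a spectral point where
  \<open>S - l\<close> is bounded below has a neighbourhood free of resolvent points.\<close>

lemma rho_if_bounded_below_near_rho:
  fixes S :: "'a::chilbert_space lop"
  assumes lin: "linear_op S" and c: "c > 0"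
    and lower: "\<And>x. x \<in> dom S \<Longrightarrow> c * norm x \<le> norm (app S x - l *\<^sub>C x)"
    and m: "m \<in> rho S" and near: "cmod (l - m) < c / 2"
  shows "l \<in> rho S"
proof (rule rho_perturbation[OF lin m])
  have "c / 2 * norm x \<le> norm (app S x - m *\<^sub>C x)" if x: "x \<in> dom S" for x
  proof -
    have "app S x - l *\<^sub>C x = (app S x - m *\<^sub>C x) - (l - m) *\<^sub>C x"
      by (simp add: scaleC_simps)
    then have "norm (app S x - l *\<^sub>C x) \<le> norm (app S x - m *\<^sub>C x) + cmod (l - m) * norm x"
      by (metis norm_triangle_ineq4 norm_scaleC)
    moreover have "cmod (l - m) * norm x \<le> c / 2 * norm x"
      using near by (intro mult_right_mono) auto
    ultimately show ?thesis using lower[OF x] by (simp add: field_simps)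
  qed
  then show "norm (resolvent S m y) \<le> 1 / (c / 2) * norm y" for y
    using norm_resolvent_le[OF m, of "c / 2"] c by simp
  show "1 / (c / 2) > 0" "cmod (l - m) * (1 / (c / 2)) < 1"
    using c near by (simp_all add: field_simps)
qed

section \<open>Products of selfadjoint operators\<close>

lemma selfadjoint_linear: "selfadjoint S \<Longrightarrow> linear_op S"
  and selfadjoint_dense: "selfadjoint S \<Longrightarrow> closure (dom S) = UNIV"
  and selfadjoint_cinner: "selfadjoint S \<Longrightarrow> x \<in> dom S \<Longrightarrow> y \<in> dom S \<Longrightarrow>
    cinner (app S x) y = cinner x (app S y)"
  unfolding selfadjoint_def by blast+

lemma cinner_dense_eq:
  fixes u :: "'a::complex_inner"
  assumes dense: "closure D = UNIV" and eq: "\<And>z. z \<in> D \<Longrightarrow> cinner z u = cinner z v"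
  shows "u = v"
proof -
  have "cmod (cinner (u - v) z) \<le> 0 * norm z" if "z \<in> D" for z
    using eq[OF that] by (subst cinner_commute) (simp add: cinner_simps)
  then have "norm (u - v) \<le> 0"
    by (intro norm_le_if_cinner_le_dense[OF dense]) auto
  then show ?thesis by simp
qed

text \<open>Selfadjointness makes the domain as large as that of the adjoint; density then
  identifies the value. Adjoint relations are converted into domain membership in this way.\<close>

lemma selfadjoint_domI:
  assumes S: "selfadjoint S" and eq: "\<And>x. x \<in> dom S \<Longrightarrow> cinner (app S x) y = cinner x z"
  shows "y \<in> dom S" and "app S y = z"
proof -
  show y: "y \<in> dom S" using S eq unfolding selfadjoint_def by blast
  show "app S y = z"
    using cinner_dense_eq[OF selfadjoint_dense[OF S]] selfadjoint_cinner[OF S _ y] eq by metis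
qed

text \<open>By symmetry of \<open>G\<close> the sets \<open>{x. \<parallel>G (f x)\<parallel> \<le> n}\<close> are closed, so Baire's theorem applies.\<close>
lemma bounded_clinear_selfadjoint_comp:
  fixes G :: "'a::chilbert_space lop"
  assumes G: "selfadjoint G" and f: "bounded_clinear f" and ran: "\<And>x. f x \<in> dom G"
  shows "bounded_clinear (\<lambda>x. app G (f x))"
proof -
  note lin = selfadjoint_linear[OF G]
  define F where "F x = app G (f x)" for x
  have F_add: "F (x + y) = F x + F y" for x y
    by (simp add: F_def bounded_clinear_add[OF f] linear_op_add[OF lin] ran)
  have F_scale: "F (c *\<^sub>C x) = c *\<^sub>C F x" for c x
    by (simp add: F_def bounded_clinear_scaleC[OF f] linear_op_scaleC[OF lin] ran)
  define E where "E n = {x. norm (F x) \<le> real n}" for n :: nat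
  have closed: "closed (E n)" for n
    unfolding closed_sequential_limits
  proof (intro allI impI)
    fix X x assume "(\<forall>k. X k \<in> E n) \<and> X \<longlonglongrightarrow> x"
    then have X: "\<And>k. norm (F (X k)) \<le> n" and lim: "X \<longlonglongrightarrow> x" by (auto simp: E_def)
    have "norm (F x) \<le> n"
    proof (rule norm_le_if_cinner_le_dense[OF selfadjoint_dense[OF G]])
      \<comment> \<open>Tested against \<open>dom G\<close>, the expression \<open>(F x, z)\<close>
        equals \<open>(f x, G z)\<close> and is therefore continuous in \<open>x\<close>.\<close>
      fix z assume z: "z \<in> dom G"
      have sym: "cinner (F x) z = cinner (f x) (app G z)" for x
        unfolding F_def by (rule selfadjoint_cinner[OF G ran z])
      have "(\<lambda>k. f (X k)) \<longlonglongrightarrow> f x"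
        using f lim bounded_linear.tendsto unfolding bounded_clinear_def by blast
      then have "(\<lambda>k. cmod (cinner (F (X k)) z)) \<longlonglongrightarrow> cmod (cinner (F x) z)"
        unfolding sym by (intro tendsto_norm tendsto_cinner tendsto_const)
      moreover have "cmod (cinner (F (X k)) z) \<le> n * norm z" for k
        using order_trans[OF cinner_Cauchy_Schwarz mult_right_mono[OF X norm_ge_zero]] .
      ultimately show "cmod (cinner (F x) z) \<le> n * norm z"
        by (intro LIMSEQ_le_const2) auto
    qed simp
    then show "x \<in> E n" by (simp add: E_def)
  qed
  have cover: "\<Union> (range E) = UNIV"
    by (auto simp: E_def) (metis real_arch_simple)
  have "\<exists>n. interior (E n) \<noteq> {}"
  proof (rule ccontr)
    assume "\<not> ?thesis"
    then have "interior (\<Union> (range E)) = {}"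
      using Met_TC.metric_Baire_category_alt[where ?'a = 'a, of "range E"] closed
      by (auto simp: complete_UNIV)
    with cover show False by simp
  qed
  then obtain n x0 where "x0 \<in> interior (E n)" by blast
  then obtain r where r: "r > 0" "cball x0 r \<subseteq> E n"
    by (meson interior_subset mem_interior_cball)
  have "norm (F x) \<le> (2 * n / r) * norm x" for x
  proof (cases "x = 0")
    case True
    then show ?thesis using F_scale[of 0 x] by simp
  next
    case False
    \<comment> \<open>Rescaling \<open>x\<close> to length \<open>r\<close> puts both
      \<open>x0\<close> and \<open>x0 + w\<close> into \<open>E n\<close>, so \<open>F w\<close>, a
      difference of two values, has norm at most \<open>2 * n\<close>.\<close>
    define w where "w = complex_of_real (r / norm x) *\<^sub>C x"
    have "norm w = r" using False r(1) by (simp add: w_def norm_scaleC norm_divide)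
    then have "x0 + w \<in> E n" "x0 \<in> E n"
      using r by (auto simp: dist_norm subset_iff)
    then have "norm (F (x0 + w) - F x0) \<le> n + n"
      by (intro order_trans[OF norm_triangle_ineq4] add_mono) (auto simp: E_def)
    then have "norm (F w) \<le> 2 * n" by (simp add: F_add)
    then have "r / norm x * norm (F x) \<le> 2 * n"
      using r(1) by (simp add: w_def F_scale norm_scaleC norm_divide)
    then show ?thesis using False r(1) by (simp add: field_simps)
  qed
  then have "bounded_clinear F"
    by (rule bounded_clinearI[OF F_add F_scale])
  then show ?thesis by (simp add: F_def[abs_def])
qed

text \<open>This is \<open>(AG - l) A = A (GA - l)\<close> read for the inverses. It applies because
  \<open>GAv = w + l v\<close> again lies in \<open>dom A\<close>, as \<open>w\<close> and
  \<open>v\<close> do.\<close>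

lemma resolvent_intertwine:
  fixes A G :: "'a::complex_inner lop"
  assumes A: "linear_op A" and l: "l \<in> rho (A \<bullet>\<^sub>o\<^sub>p G)" "l \<in> rho (G \<bullet>\<^sub>o\<^sub>p A)" and w: "w \<in> dom A"
  shows "resolvent (A \<bullet>\<^sub>o\<^sub>p G) l (app A w) = app A (resolvent (G \<bullet>\<^sub>o\<^sub>p A) l w)"
proof -
  let ?v = "resolvent (G \<bullet>\<^sub>o\<^sub>p A) l w"
  have v: "?v \<in> dom A" "app A ?v \<in> dom G" "app G (app A ?v) = w + l *\<^sub>C ?v"
    using resolvent_in_dom[OF l(2), of w] app_resolvent[OF l(2), of w]
    by (simp_all add: dom_op_mult app_op_mult)
  then have "app A ?v \<in> dom (A \<bullet>\<^sub>o\<^sub>p G)"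
    "app (A \<bullet>\<^sub>o\<^sub>p G) (app A ?v) - l *\<^sub>C app A ?v = app A w"
    using w by (simp_all add: dom_op_mult app_op_mult linear_op_add[OF A] linear_op_scaleC[OF A])
  then show ?thesis
    using resolvent_app[OF l(1)] by metis
qed

lemma bounded_clinear_app_resolvent:
  fixes A G :: "'a::chilbert_space lop"
  assumes A: "selfadjoint A" and G: "selfadjoint G" and l: "l \<in> rho (A \<bullet>\<^sub>o\<^sub>p G)"
  shows "bounded_clinear (\<lambda>x. app G (resolvent (A \<bullet>\<^sub>o\<^sub>p G) l x))"
proof (rule bounded_clinear_selfadjoint_comp[OF G])
  show "bounded_clinear (resolvent (A \<bullet>\<^sub>o\<^sub>p G) l)"
    by (intro bounded_clinear_resolvent linear_op_mult selfadjoint_linear A G l)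
  show "resolvent (A \<bullet>\<^sub>o\<^sub>p G) l x \<in> dom G" for x
    using resolvent_in_dom[OF l] by (simp add: dom_op_mult)
qed

text \<open>On \<open>dom G\<close> the inverse of \<open>AG - l\<close> is \<open>(A (GA - l)\<^sup>-\<^sup>1 G - 1) / l\<close>; conjugating with \<open>AG - m\<close>
  extends it to the whole space.\<close>
lemma rho_product_swap:
  fixes A G :: "'a::chilbert_space lop"
  assumes A: "selfadjoint A" and G: "selfadjoint G"
    and m: "m \<in> rho (A \<bullet>\<^sub>o\<^sub>p G)" and l: "l \<in> rho (G \<bullet>\<^sub>o\<^sub>p A)" and "l \<noteq> 0"
  shows "l \<in> rho (A \<bullet>\<^sub>o\<^sub>p G)"
proof -
  note linA = selfadjoint_linear[OF A] and linG = selfadjoint_linear[OF G]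
  let ?T = "A \<bullet>\<^sub>o\<^sub>p G"
  note lin = linear_op_mult[OF linA linG]
  define R where "R = resolvent ?T m"
  define u where "u y = resolvent (G \<bullet>\<^sub>o\<^sub>p A) l (app G (R y))" for y
  \<comment> \<open>\<open>w y\<close> is the stated formula for
    \<open>(AG - l)\<^sup>-\<^sup>1\<close> applied to \<open>R y\<close>, and \<open>f\<close>
    comes from the resolvent identity \<open>(T - l)\<^sup>-\<^sup>1 = (l - m) (T -
    l)\<^sup>-\<^sup>1 R + R\<close>.\<close>
  define w where "w y = (1 / l) *\<^sub>C (app A (u y) + (-1) *\<^sub>C R y)" for y
  define f where "f y = (l - m) *\<^sub>C w y + R y" for y
  have R: "bounded_clinear R"
    unfolding R_def by (rule bounded_clinear_resolvent[OF lin m])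
  have "bounded_clinear (\<lambda>y. app A (u y))"
    unfolding u_def
    using bounded_clinear_compose[OF bounded_clinear_app_resolvent[OF G A l]
        bounded_clinear_app_resolvent[OF A G m]]
    by (simp add: R_def)
  then have f: "bounded_clinear f"
    unfolding f_def w_def
    by (intro bounded_clinear_plus bounded_clinear_scaled R)
  then obtain K where K: "K > 0" "\<And>y. norm (f y) \<le> K * norm y"
    by (rule bounded_clinear_bound) blast
  have inv: "f y \<in> dom ?T \<and> app ?T (f y) - l *\<^sub>C f y = y" for y
  proof -
    have Ry: "R y \<in> dom ?T" "app ?T (R y) = y + m *\<^sub>C R y"
      using resolvent_in_dom[OF m] app_resolvent[OF m] by (simp_all add: R_def)
    have u: "u y \<in> dom A" "app A (u y) \<in> dom G" "app G (app A (u y)) = app G (R y) + l *\<^sub>C u y"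
      using resolvent_in_dom[OF l] app_resolvent[OF l]
      by (auto simp: u_def dom_op_mult app_op_mult)
    have wG: "w y \<in> dom G" "app G (w y) = u y"
      using u Ry \<open>l \<noteq> 0\<close>
      by (simp_all add: w_def dom_op_mult linear_op_add[OF linG] linear_op_scaleC[OF linG]
          linear_op_diff[OF linG] scaleC_simps)
    then have wT: "w y \<in> dom ?T" "app ?T (w y) = l *\<^sub>C w y + R y"
      using u \<open>l \<noteq> 0\<close> by (simp_all add: dom_op_mult app_op_mult w_def scaleC_simps)
    have "f y \<in> dom ?T"
      by (simp add: f_def linear_op_add[OF lin] linear_op_scaleC[OF lin] wT Ry)
    moreover have "app ?T (f y) = (l - m) *\<^sub>C (l *\<^sub>C w y + R y) + (y + m *\<^sub>C R y)"
      by (simp add: f_def linear_op_add[OF lin] linear_op_scaleC[OF lin] wT Ry)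
    then have "app ?T (f y) - l *\<^sub>C f y = y"
      by (simp add: f_def scaleC_simps algebra_simps)
    ultimately show ?thesis by blast
  qed
  show ?thesis
  proof (rule rho_if_right_inverse[OF lin K(1) _ _ K(2)])
    \<comment> \<open>If \<open>x\<close> is in the kernel of \<open>AG - l\<close>, then
      \<open>G x\<close> is in the kernel of \<open>GA - l\<close>; so \<open>G x = 0\<close> and
      \<open>l x = A (G x) = 0\<close>.\<close>
    fix x assume x: "x \<in> dom ?T" and eq: "app ?T x = l *\<^sub>C x"
    then have "app G x \<in> dom (G \<bullet>\<^sub>o\<^sub>p A)"
      "app (G \<bullet>\<^sub>o\<^sub>p A) (app G x) - l *\<^sub>C app G x = 0"
      by (simp_all add: dom_op_mult app_op_mult linear_op_scaleC[OF linG])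
    then have "resolvent (G \<bullet>\<^sub>o\<^sub>p A) l 0 = app G x"
      using resolvent_app[OF l] by metis
    moreover have "bounded_clinear (resolvent (G \<bullet>\<^sub>o\<^sub>p A) l)"
      by (intro bounded_clinear_resolvent linear_op_mult linA linG l)
    then have "resolvent (G \<bullet>\<^sub>o\<^sub>p A) l 0 = 0"
      using bounded_clinear_scaleC[of "resolvent (G \<bullet>\<^sub>o\<^sub>p A) l" 0 0] by simp
    ultimately have "app G x = 0" by simp
    then have "l *\<^sub>C x = 0"
      using eq linear_op_zero[OF linA] by (simp add: app_op_mult)
    then have "cmod l * norm x = 0"
      by (metis norm_scaleC norm_zero)
    with \<open>l \<noteq> 0\<close> show "x = 0" by simp
  qed (use inv in auto)
qed

text \<open>The adjoint of \<open>(AG - l)\<^sup>-\<^sup>1\<close> inverts \<open>GA - cnj l\<close>.\<close>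
lemma cnj_rho_product:
  fixes A G :: "'a::chilbert_space lop"
  assumes A: "selfadjoint A" and G: "selfadjoint G"
    and l: "l \<in> rho (A \<bullet>\<^sub>o\<^sub>p G)" "l \<in> rho (G \<bullet>\<^sub>o\<^sub>p A)"
  shows "cnj l \<in> rho (G \<bullet>\<^sub>o\<^sub>p A)"
proof -
  note linA = selfadjoint_linear[OF A] and linG = selfadjoint_linear[OF G]
  let ?RT = "resolvent (A \<bullet>\<^sub>o\<^sub>p G) l" and ?RS = "resolvent (G \<bullet>\<^sub>o\<^sub>p A) l"
  note RT = bounded_clinear_resolvent[OF linear_op_mult[OF linA linG] l(1)]
  obtain g K where g: "\<And>x y. cinner (?RT x) y = cinner x (g y)" and K: "K > 0" "\<And>y. norm (g y) \<le> K * norm y"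
    using bounded_clinear_adjoint[OF RT] by metis
  obtain b where b: "\<And>x y. cinner (app A (?RS x)) y = cinner x (b y)"
    using bounded_clinear_adjoint[OF bounded_clinear_app_resolvent[OF G A l(2)]] by metis
  \<comment> \<open>The adjoint relation for
    \<open>(AG - l)\<^sup>-\<^sup>1 A = A (GA - l)\<^sup>-\<^sup>1\<close> on
    \<open>dom A\<close>.\<close>
  have gA: "g y \<in> dom A \<and> app A (g y) = b y" for y
  proof -
    have "cinner (app A w) (g y) = cinner w (b y)" if "w \<in> dom A" for w
      by (simp add: resolvent_intertwine[OF linA l that] flip: g b)
    from selfadjoint_domI[OF A this] show ?thesis by blast
  qed
  \<comment> \<open>Here the intertwining is used with \<open>A\<close> and \<open>G\<close>
    exchanged: on \<open>dom G\<close>, \<open>A (GA - l)\<^sup>-\<^sup>1 G\<close> acts as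
    \<open>AG (AG - l)\<^sup>-\<^sup>1 = 1 + l (AG - l)\<^sup>-\<^sup>1\<close>.\<close>
  have bG: "b y \<in> dom G \<and> app G (b y) = y + cnj l *\<^sub>C g y" for y
  proof -
    have "cinner (app G w) (b y) = cinner w (y + cnj l *\<^sub>C g y)" if w: "w \<in> dom G" for w
    proof -
      have "cinner (app G w) (b y) = cinner (app A (app G (?RT w))) y"
        by (simp add: resolvent_intertwine[OF linG l(2,1) w] flip: b)
      also have "\<dots> = cinner (w + l *\<^sub>C ?RT w) y"
        using app_resolvent[OF l(1)] by (simp add: app_op_mult)
      also have "\<dots> = cinner w (y + cnj l *\<^sub>C g y)"
        by (simp add: cinner_simps g)
      finally show ?thesis .
    qed
    from selfadjoint_domI[OF G this] show ?thesis by blast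
  qed
  show ?thesis
  proof (rule rho_if_right_inverse[OF linear_op_mult[OF linG linA] K(1) _ _ K(2)])
    show "g y \<in> dom (G \<bullet>\<^sub>o\<^sub>p A)" "app (G \<bullet>\<^sub>o\<^sub>p A) (g y) - cnj l *\<^sub>C g y = y" for y
      using gA bG by (simp_all add: dom_op_mult app_op_mult)
    fix u assume u: "u \<in> dom (G \<bullet>\<^sub>o\<^sub>p A)" and eq: "app (G \<bullet>\<^sub>o\<^sub>p A) u = cnj l *\<^sub>C u"
    \<comment> \<open>Injectivity: \<open>u = (AG - l) x\<close> is in the range, and
      \<open>(u, (AG - l) x) = ((GA - cnj l) u, x) = 0\<close>.\<close>
    define x where "x = ?RT u"
    have x: "x \<in> dom (A \<bullet>\<^sub>o\<^sub>p G)" "u = app (A \<bullet>\<^sub>o\<^sub>p G) x - l *\<^sub>C x"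
      using resolvent_in_dom[OF l(1)] app_resolvent[OF l(1)] by (simp_all add: x_def)
    have "cinner u u = cinner u (app A (app G x)) - cnj l * cinner u x"
      by (subst (2) x(2)) (simp add: cinner_simps app_op_mult)
    also have "cinner u (app A (app G x)) = cinner (app G (app A u)) x"
      using u x(1) selfadjoint_cinner[OF A] selfadjoint_cinner[OF G] by (simp add: dom_op_mult)
    also have "\<dots> = cnj l * cinner u x"
      using eq by (simp add: app_op_mult cinner_simps)
    finally show "u = 0" by (intro cinner_eq_zeroD) simp
  qed
qed

text \<open>The factors are swapped, the point is reflected, and the factors are swapped back; both
  swaps divide by the spectral parameter, hence \<open>l \<noteq> 0\<close>.\<close>

lemma cnj_rho:
  fixes A G :: "'a::chilbert_space lop"
  assumes A: "selfadjoint A" and G: "selfadjoint G"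
    and l: "l \<in> rho (A \<bullet>\<^sub>o\<^sub>p G)" "l \<noteq> 0" and n: "n \<in> rho (G \<bullet>\<^sub>o\<^sub>p A)"
  shows "cnj l \<in> rho (A \<bullet>\<^sub>o\<^sub>p G)"
proof -
  have "l \<in> rho (G \<bullet>\<^sub>o\<^sub>p A)"
    by (rule rho_product_swap[OF G A n l])
  then have "cnj l \<in> rho (G \<bullet>\<^sub>o\<^sub>p A)"
    by (rule cnj_rho_product[OF A G l(1)])
  then show ?thesis
    using rho_product_swap[OF A G l(1)] l(2) by simp
qed

section \<open>The definitizing form\<close>

text \<open>The base point \<open>\<mu>\<close> is left free so that it can later be specialized to
  \<open>cnj l0\<close>, where \<open>R\<close> matches the form given by \<open>G0\<close>. The
  point \<open>\<nu>\<close> supplies the bounded operator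
  \<open>A (GA - \<nu>)\<^sup>-\<^sup>1\<close> and the reflection of resolvent points.\<close>

locale definitized_pair =
  fixes A G :: "'a::chilbert_space lop" and p :: "real poly" and \<mu> \<nu> :: complex
  assumes A: "selfadjoint A" and G: "selfadjoint G"
    and \<mu>: "\<mu> \<in> rho (A \<bullet>\<^sub>o\<^sub>p G)" and \<nu>: "\<nu> \<in> rho (G \<bullet>\<^sub>o\<^sub>p A)"
    and p: "definitizing A G p"
begin

abbreviation T :: "'a lop" where "T \<equiv> A \<bullet>\<^sub>o\<^sub>p G"

abbreviation (input) defect :: "complex \<Rightarrow> 'a \<Rightarrow> 'a" where "defect l x \<equiv> app T x - l *\<^sub>C x"

abbreviation pc :: "complex \<Rightarrow> complex" where "pc \<equiv> poly (map_poly complex_of_real p)"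

definition R :: "'a \<Rightarrow> 'a" where "R = resolvent T \<mu>"

text \<open>The same power as in \<open>definitizing\<close>; being at least 1, it sends every
  vector into \<open>dom T\<close> even when \<open>p\<close> is constant.\<close>

definition d :: nat where "d = max 1 (degree p)"

text \<open>The bounded operator \<open>T R\<close>, written without the unbounded
  \<open>T\<close>.\<close>

definition TR :: "'a \<Rightarrow> 'a" where "TR x = x + \<mu> *\<^sub>C R x"

text \<open>The bounded operators \<open>p(T) R\<^sup>d\<close> and \<open>G R\<^sup>d\<close>.\<close>
definition P :: "'a \<Rightarrow> 'a" where
  "P x = (\<Sum>i\<le>degree p. complex_of_real (coeff p i) *\<^sub>C (TR ^^ i) ((R ^^ (d - i)) x))"

definition GR :: "'a \<Rightarrow> 'a" where "GR x = app G ((R ^^ d) x)"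

definition Q :: "'a \<Rightarrow> real" where "Q x = Re (cinner (P x) (GR x))"

lemmas linA = selfadjoint_linear[OF A]
  and linG = selfadjoint_linear[OF G]
lemmas linT = linear_op_mult[OF linA linG]

section \<open>Calculus of the resolvent \<open>R\<close> and the bounded positive form\<close>

lemma bounded_clinear_R: "bounded_clinear R"
  unfolding R_def by (rule bounded_clinear_resolvent[OF linT \<mu>])

lemma bounded_clinear_TR: "bounded_clinear TR"
  unfolding TR_def by (intro bounded_clinear_plus bounded_clinear_ident bounded_clinear_scaled bounded_clinear_R)

lemmas R_linear = bounded_clinear_add[OF bounded_clinear_R] bounded_clinear_diff[OF bounded_clinear_R]
  bounded_clinear_scaleC[OF bounded_clinear_R]
  and Rn_linear = bounded_clinear_add[OF bounded_clinear_funpow[OF bounded_clinear_R]]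
  bounded_clinear_diff[OF bounded_clinear_funpow[OF bounded_clinear_R]]
  bounded_clinear_scaleC[OF bounded_clinear_funpow[OF bounded_clinear_R]]

lemma R_dom: "R x \<in> dom T"
  unfolding R_def by (rule resolvent_in_dom[OF \<mu>])

lemma app_R: "app T (R x) = TR x"
  unfolding R_def TR_def by (rule app_resolvent[OF \<mu>])

lemma R_app: "x \<in> dom T \<Longrightarrow> R (app T x) = TR x"
  using resolvent_app[OF \<mu>, of x] unfolding R_def[symmetric] TR_def
  by (simp add: R_linear algebra_simps)

lemma TR_R: "TR (R x) = R (TR x)"
  by (simp add: TR_def R_linear)

lemma TR_funpow_R: "(TR ^^ i) (R x) = R ((TR ^^ i) x)"
  by (induction i) (simp_all add: TR_R)

lemma Rn_dom: "0 < n \<Longrightarrow> (R ^^ n) x \<in> dom T"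
  by (cases n) (simp_all add: R_dom)

lemma d_pos: "0 < d"
  by (simp add: d_def)

lemma dom_T_G: "x \<in> dom T \<Longrightarrow> x \<in> dom G" "x \<in> dom T \<Longrightarrow> app G x \<in> dom A"
  by (simp_all add: dom_op_mult)

lemma T_symmetric:
  "x \<in> dom T \<Longrightarrow> y \<in> dom T \<Longrightarrow> cinner (app T x) (app G y) = cinner (app G x) (app T y)"
  using selfadjoint_cinner[OF A] by (simp add: dom_op_mult app_op_mult)

text \<open>Each application of \<open>T\<close> uses up one factor \<open>R\<close> and turns it
  into the bounded \<open>TR\<close>.\<close>

lemma app_funpow_Rn: "i \<le> n \<Longrightarrow> (app T ^^ i) ((R ^^ n) x) = (TR ^^ i) ((R ^^ (n - i)) x)"
proof (induction i)
  case (Suc i)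
  then have "(R ^^ (n - i)) x = R ((R ^^ (n - Suc i)) x)"
    by (metis Suc_diff_Suc Suc_le_lessD comp_apply funpow.simps(2))
  with Suc show ?case by (simp add: TR_funpow_R app_R)
qed simp

lemma app_funpow_Rn_dom: "i < n \<Longrightarrow> (app T ^^ i) ((R ^^ n) x) \<in> dom T"
proof -
  assume i: "i < n"
  then have "(R ^^ (n - i)) x = R ((R ^^ (n - Suc i)) x)"
    by (metis Suc_diff_Suc comp_apply funpow.simps(2))
  with i show ?thesis by (simp add: app_funpow_Rn TR_funpow_R R_dom)
qed

text \<open>\<open>T\<close> and \<open>R\<close> commute on \<open>dom T\<close>. The induction
  separates \<open>n = 0\<close>, where membership of the argument in \<open>dom T\<close> is the
  hypothesis, from positive powers, whose range is in \<open>dom T\<close>.\<close>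

lemma defect_Rn: "x \<in> dom T \<Longrightarrow> defect l ((R ^^ n) x) = (R ^^ n) (defect l x)"
proof (induction n)
  case (Suc n)
  show ?case
  proof (cases n)
    case 0
    with Suc.prems show ?thesis by (simp add: app_R R_linear R_app)
  next
    case (Suc k)
    then have "(R ^^ n) x \<in> dom T" by (simp add: R_dom)
    then have "app T (R ((R ^^ n) x)) = R (app T ((R ^^ n) x))"
      by (simp add: app_R R_app)
    then have "defect l ((R ^^ Suc n) x) = R (defect l ((R ^^ n) x))"
      by (simp add: R_linear)
    then show ?thesis by (simp add: Suc.IH[OF Suc.prems])
  qed
qed simp

lemma poly_op_Rn: "poly_op p T ((R ^^ d) x) = P x"
  unfolding poly_op_def P_def by (intro sum.cong refl) (simp add: app_funpow_Rn d_def)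

text \<open>\<open>R ^^ d\<close> maps the whole space into the domain of the power of
  \<open>T\<close> on which the definitizing inequality holds.\<close>

lemma
  shows form_real: "Im (cinner (P x) (GR x)) = 0"
    and form_nonneg: "0 \<le> Re (cinner (P x) (GR x))"
proof -
  have "(R ^^ d) x \<in> dom (op_pow T (max 1 (degree p)))"
    using app_funpow_Rn_dom[of _ d x] by (simp add: op_pow_def dom_def d_def)
  then show "Im (cinner (P x) (GR x)) = 0" "0 \<le> Re (cinner (P x) (GR x))"
    using p unfolding definitizing_def GR_def poly_op_Rn[symmetric] by blast+
qed

lemma bounded_clinear_P: "bounded_clinear P"
  unfolding P_def
  by (intro bounded_clinear_sum bounded_clinear_scaled
      bounded_clinear_compose[OF bounded_clinear_funpow[OF bounded_clinear_TR]
        bounded_clinear_funpow[OF bounded_clinear_R]])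

lemma bounded_clinear_app_G_R: "bounded_clinear (\<lambda>x. app G (R x))"
  using bounded_clinear_app_resolvent[OF A G \<mu>] by (simp add: R_def)

lemma bounded_clinear_GR: "bounded_clinear GR"
proof -
  obtain n where n: "d = Suc n" using d_pos gr0_implies_Suc by blast
  show ?thesis
    unfolding GR_def n
    using bounded_clinear_compose[OF bounded_clinear_app_G_R bounded_clinear_funpow[OF bounded_clinear_R, of n]]
    by simp
qed

lemma form_Cauchy_Schwarz: "(cmod (cinner (P x) (GR w)))\<^sup>2 \<le> Q x * Q w"
  unfolding Q_def
  by (rule sesquilinear_Cauchy_Schwarz[where B = "\<lambda>x w. cinner (P x) (GR w)"])
    (simp_all add: form_real form_nonneg cinner_simps bounded_clinear_add[OF bounded_clinear_P]
      bounded_clinear_scaleC[OF bounded_clinear_P] bounded_clinear_add[OF bounded_clinear_GR]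
      bounded_clinear_scaleC[OF bounded_clinear_GR])

section \<open>Replacing \<open>T\<close> by the scalar \<open>l\<close> on approximate
  eigenvectors\<close>

lemma R_eq_defect: "x \<in> dom T \<Longrightarrow> x = R (defect l x) + (l - \<mu>) *\<^sub>C R x"
  using R_app[of x] by (simp add: R_linear TR_def scaleC_simps)

lemma TR_eq_defect: "x \<in> dom T \<Longrightarrow> TR x = R (defect l x) + l *\<^sub>C R x"
  by (simp add: R_linear R_app)

lemma TR_Rn: "TR ((R ^^ n) x) = (R ^^ n) (TR x)"
  by (induction n) (simp_all add: TR_R)

text \<open>By \<open>TR x = R ((T - l) x) + l R x\<close>, each factor \<open>TR\<close> may be
  exchanged for \<open>l R\<close> at the cost of a multiple of the defect. The constant is uniform
  on \<open>cmod l \<le> M\<close>; \<open>\<bar>M\<bar>\<close> keeps it nonnegative for every real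
  \<open>M\<close>.\<close>

lemma TR_funpow_approx:
  "\<exists>C\<ge>0. \<forall>l x. cmod l \<le> M \<longrightarrow> x \<in> dom T \<longrightarrow>
     norm ((TR ^^ i) ((R ^^ j) x) - l ^ i *\<^sub>C (R ^^ (i + j)) x) \<le> C * norm (defect l x)"
proof (induction i arbitrary: j)
  case 0
  show ?case by (auto simp: scaleC_simps)
next
  case (Suc i)
  obtain C where C: "C \<ge> 0" "\<And>l x. cmod l \<le> M \<Longrightarrow> x \<in> dom T \<Longrightarrow>
     norm ((TR ^^ i) ((R ^^ Suc j) x) - l ^ i *\<^sub>C (R ^^ (i + Suc j)) x) \<le> C * norm (defect l x)"
    using Suc.IH[of "Suc j"] by blast
  let ?F = "\<lambda>x. (TR ^^ i) ((R ^^ Suc j) x)"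
  have F: "bounded_clinear ?F"
    using bounded_clinear_compose[OF bounded_clinear_funpow[OF bounded_clinear_TR]
        bounded_clinear_funpow[OF bounded_clinear_R]] .
  obtain K where K: "K > 0" "\<And>x. norm (?F x) \<le> K * norm x"
    using bounded_clinear_bound[OF F] by blast
  have "norm ((TR ^^ Suc i) ((R ^^ j) x) - l ^ Suc i *\<^sub>C (R ^^ (Suc i + j)) x)
      \<le> (\<bar>M\<bar> * C + K) * norm (defect l x)" if l: "cmod l \<le> M" and x: "x \<in> dom T" for l x
  proof -
    have "(TR ^^ Suc i) ((R ^^ j) x) = (TR ^^ i) ((R ^^ j) (TR x))"
      by (simp add: funpow_swap1 TR_Rn)
    also have "\<dots> = (TR ^^ i) ((R ^^ j) (R (defect l x + l *\<^sub>C x)))"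
      by (simp only: TR_eq_defect[OF x, of l] R_linear)
    also have "\<dots> = ?F (defect l x + l *\<^sub>C x)"
      by (simp add: funpow_swap1 del: diff_add_cancel)
    also have "\<dots> = ?F (defect l x) + l *\<^sub>C ?F x"
      by (simp only: bounded_clinear_add[OF F] bounded_clinear_scaleC[OF F])
    finally have eq: "(TR ^^ Suc i) ((R ^^ j) x) - l ^ Suc i *\<^sub>C (R ^^ (Suc i + j)) x
        = l *\<^sub>C (?F x - l ^ i *\<^sub>C (R ^^ (i + Suc j)) x) + ?F (defect l x)"
      by (simp add: scaleC_simps)
    have "norm (l *\<^sub>C (?F x - l ^ i *\<^sub>C (R ^^ (i + Suc j)) x)) \<le> \<bar>M\<bar> * (C * norm (defect l x))"
      unfolding norm_scaleC using l by (intro mult_mono C x) auto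
    from norm_triangle_mono[OF this K(2)] show ?thesis
      unfolding eq distrib_right mult.assoc .
  qed
  then show ?case
    using C(1) K(1) by (intro exI[of _ "\<bar>M\<bar> * C + K"]) auto
qed

text \<open>Iterates \<open>x = R ((T - l) x) + (l - \<mu>) R x\<close>. The map \<open>F\<close> is
  later the identity or \<open>G\<close>: it may be unbounded as long as \<open>F R\<close> is
  bounded.\<close>

lemma Rn_approx:
  assumes F: "bounded_clinear (\<lambda>x. F (R x))"
    and F_lin: "\<And>x y c. x \<in> dom T \<Longrightarrow> y \<in> dom T \<Longrightarrow> F (x + c *\<^sub>C y) = F x + c *\<^sub>C F y"
  shows "\<exists>C\<ge>0. \<forall>l x. cmod l \<le> M \<longrightarrow> x \<in> dom T \<longrightarrow>
     norm (F x - (l - \<mu>) ^ n *\<^sub>C F ((R ^^ n) x)) \<le> C * norm (defect l x)"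
proof (induction n)
  case 0
  show ?case by (auto simp: scaleC_simps)
next
  case (Suc n)
  obtain C where C: "C \<ge> 0" "\<And>l x. cmod l \<le> M \<Longrightarrow> x \<in> dom T \<Longrightarrow>
     norm (F x - (l - \<mu>) ^ n *\<^sub>C F ((R ^^ n) x)) \<le> C * norm (defect l x)"
    using Suc.IH by blast
  obtain K where K: "K > 0" "\<And>x. norm (F (R ((R ^^ n) x))) \<le> K * norm x"
    using bounded_clinear_bound[OF bounded_clinear_compose[OF F bounded_clinear_funpow[OF bounded_clinear_R]]]
    by blast
  let ?a = "\<bar>M\<bar> + cmod \<mu>"
  have "norm (F x - (l - \<mu>) ^ Suc n *\<^sub>C F ((R ^^ Suc n) x)) \<le> (C + ?a ^ n * K) * norm (defect l x)"
    if l: "cmod l \<le> M" and x: "x \<in> dom T" for l x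
  proof -
    have "(R ^^ n) x = (R ^^ n) (R (defect l x) + (l - \<mu>) *\<^sub>C R x)"
      using R_eq_defect[OF x, of l] by simp
    also have "\<dots> = R ((R ^^ n) (defect l x)) + (l - \<mu>) *\<^sub>C R ((R ^^ n) x)"
      by (simp only: Rn_linear(1,3) funpow_swap1)
    finally have "F ((R ^^ n) x) = F (R ((R ^^ n) (defect l x))) + (l - \<mu>) *\<^sub>C F (R ((R ^^ n) x))"
      by (metis F_lin R_dom)
    then have eq: "F x - (l - \<mu>) ^ Suc n *\<^sub>C F ((R ^^ Suc n) x)
        = (F x - (l - \<mu>) ^ n *\<^sub>C F ((R ^^ n) x)) + (l - \<mu>) ^ n *\<^sub>C F (R ((R ^^ n) (defect l x)))"
      by (simp add: scaleC_add_right scaleC_scaleC mult.commute)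
    have "cmod (l - \<mu>) \<le> ?a"
      using norm_triangle_ineq4[of l \<mu>] l by linarith
    then have "norm ((l - \<mu>) ^ n *\<^sub>C F (R ((R ^^ n) (defect l x)))) \<le> ?a ^ n * (K * norm (defect l x))"
      unfolding norm_scaleC norm_power by (intro mult_mono K power_mono) auto
    from norm_triangle_mono[OF C(2)[OF l x] this] show ?thesis
      unfolding eq distrib_right mult.assoc .
  qed
  then show ?case
    using C(1) K(1) by (intro exI[of _ "C + ?a ^ n * K"]) auto
qed

text \<open>The approximation is transferred to the other slot: symmetry of \<open>T\<close> with
  respect to \<open>(G x, y)\<close> lets powers of \<open>R\<close> be inserted in front of an
  arbitrary \<open>w\<close>. The conjugate of \<open>\<mu>\<close> stems from conjugate linearity
  in the second slot.\<close>

lemma dual_approx: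
  "\<exists>C\<ge>0. \<forall>l y w. cmod l \<le> M \<longrightarrow> y \<in> dom T \<longrightarrow>
     cmod (cinner (app G y) w - (l - cnj \<mu>) ^ n * cinner (app G y) ((R ^^ n) w))
       \<le> C * norm (defect l y) * norm w"
proof (induction n)
  case 0
  show ?case by auto
next
  case (Suc n)
  obtain C where C: "C \<ge> 0" "\<And>l y w. cmod l \<le> M \<Longrightarrow> y \<in> dom T \<Longrightarrow>
     cmod (cinner (app G y) w - (l - cnj \<mu>) ^ n * cinner (app G y) ((R ^^ n) w))
       \<le> C * norm (defect l y) * norm w"
    using Suc.IH by blast
  obtain K where K: "K > 0" "\<And>x. norm (app G (R ((R ^^ n) x))) \<le> K * norm x"
    using bounded_clinear_bound[OF bounded_clinear_compose[OF bounded_clinear_app_G_R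
          bounded_clinear_funpow[OF bounded_clinear_R]]] by blast
  let ?a = "\<bar>M\<bar> + cmod \<mu>"
  have "cmod (cinner (app G y) w - (l - cnj \<mu>) ^ Suc n * cinner (app G y) ((R ^^ Suc n) w))
       \<le> (C + ?a ^ n * K) * norm (defect l y) * norm w"
    if l: "cmod l \<le> M" and y: "y \<in> dom T" for l y w
  proof -
    let ?w = "(R ^^ n) w"
    have Gsym: "cinner y (app G (R ?w)) = cinner (app G y) (R ?w)"
      using selfadjoint_cinner[OF G] dom_T_G(1)[OF y] dom_T_G(1)[OF R_dom] by metis
    \<comment> \<open>Write \<open>?w = (T - \<mu>) (R ?w)\<close> and move \<open>T\<close> over to
      \<open>y\<close>.\<close>
    have step: "cinner (app G y) ?w - (l - cnj \<mu>) * cinner (app G y) (R ?w)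
        = cinner (defect l y) (app G (R ?w))"
      by (simp add: cinner_simps T_symmetric[OF y R_dom] app_R TR_def Gsym algebra_simps)
    have eq: "cinner (app G y) w - (l - cnj \<mu>) ^ Suc n * cinner (app G y) ((R ^^ Suc n) w)
       = (cinner (app G y) w - (l - cnj \<mu>) ^ n * cinner (app G y) ?w)
         + (l - cnj \<mu>) ^ n * cinner (defect l y) (app G (R ?w))"
      unfolding step[symmetric] by (simp add: algebra_simps)
    have "cmod (l - cnj \<mu>) \<le> ?a"
      using norm_triangle_ineq4[of l "cnj \<mu>"] l by simp
    moreover have "cmod (cinner (defect l y) (app G (R ?w))) \<le> K * (norm (defect l y) * norm w)"
      using order_trans[OF cinner_Cauchy_Schwarz mult_left_mono[OF K(2) norm_ge_zero]]
      by (simp only: mult.left_commute)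
    ultimately have "cmod ((l - cnj \<mu>) ^ n * cinner (defect l y) (app G (R ?w)))
        \<le> ?a ^ n * (K * (norm (defect l y) * norm w))"
      unfolding norm_mult norm_power by (intro mult_mono power_mono) auto
    from norm_triangle_mono[OF C(2)[OF l y] this] show ?thesis
      unfolding eq distrib_right mult.assoc .
  qed
  then show ?case
    using C(1) K(1) by (intro exI[of _ "C + ?a ^ n * K"]) auto
qed

lemma pc_eq: "pc l = (\<Sum>i\<le>degree p. complex_of_real (coeff p i) * l ^ i)"
  by (simp add: poly_altdef degree_map_poly coeff_map_poly)

lemma P_approx:
  "\<exists>C\<ge>0. \<forall>l x. cmod l \<le> M \<longrightarrow> x \<in> dom T \<longrightarrow>
     norm (P x - pc l *\<^sub>C (R ^^ d) x) \<le> C * norm (defect l x)"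
proof -
  have "\<exists>C. C \<ge> 0 \<and> (\<forall>l x. cmod l \<le> M \<longrightarrow> x \<in> dom T \<longrightarrow>
     norm ((TR ^^ i) ((R ^^ (d - i)) x) - l ^ i *\<^sub>C (R ^^ (i + (d - i))) x) \<le> C * norm (defect l x))" for i
    using TR_funpow_approx by blast
  then obtain C where C: "\<And>i. C i \<ge> 0" "\<And>i l x. cmod l \<le> M \<Longrightarrow> x \<in> dom T \<Longrightarrow>
     norm ((TR ^^ i) ((R ^^ (d - i)) x) - l ^ i *\<^sub>C (R ^^ (i + (d - i))) x) \<le> C i * norm (defect l x)"
    by metis
  let ?c = "\<lambda>i. complex_of_real (coeff p i)"
  have "norm (P x - pc l *\<^sub>C (R ^^ d) x) \<le> (\<Sum>i\<le>degree p. cmod (?c i) * C i) * norm (defect l x)"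
    if l: "cmod l \<le> M" and x: "x \<in> dom T" for l x
  proof -
    have "P x - pc l *\<^sub>C (R ^^ d) x
        = (\<Sum>i\<le>degree p. ?c i *\<^sub>C ((TR ^^ i) ((R ^^ (d - i)) x) - l ^ i *\<^sub>C (R ^^ (i + (d - i))) x))"
      unfolding P_def pc_eq scaleC_sum_left sum_subtractf[symmetric]
      by (intro sum.cong refl) (simp add: scaleC_simps d_def)
    also have "norm \<dots> \<le> (\<Sum>i\<le>degree p. cmod (?c i) * (C i * norm (defect l x)))"
      by (intro sum_norm_le) (auto simp only: norm_scaleC intro!: mult_left_mono C l x norm_ge_zero)
    finally show ?thesis by (simp add: sum_distrib_right mult.assoc)
  qed
  then show ?thesis
    using C(1) by (intro exI[of _ "\<Sum>i\<le>degree p. cmod (?c i) * C i"]) (auto intro!: sum_nonneg)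
qed

lemma pc_bounded: "\<exists>C\<ge>0. \<forall>l. cmod l \<le> M \<longrightarrow> cmod (pc l) \<le> C"
proof -
  have "compact (pc ` cball 0 M)"
    by (intro compact_continuous_image continuous_intros compact_cball)
  then obtain C where "\<And>z. z \<in> pc ` cball 0 M \<Longrightarrow> norm z \<le> C"
    using compact_imp_bounded bounded_iff by metis
  then show ?thesis
    by (intro exI[of _ "max 0 C"]) force
qed

section \<open>Norm estimates through the definitizing form\<close>

lemma Q_nonneg: "0 \<le> Q x"
  by (simp add: Q_def form_nonneg)

text \<open>Cauchy-Schwarz for the form, with \<open>Q w\<close> bounded by a multiple of
  \<open>(norm w)\<^sup>2\<close>; only the factor belonging to \<open>x\<close> keeps its
  \<open>sqrt (Q x)\<close>.\<close>

lemma form_bound: "\<exists>C\<ge>0. \<forall>x w. cmod (cinner (P x) (GR w)) \<le> C * sqrt (Q x) * norm w"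
proof -
  obtain KP where KP: "KP > 0" "\<And>x. norm (P x) \<le> KP * norm x"
    using bounded_clinear_bound[OF bounded_clinear_P] by blast
  obtain KG where KG: "KG > 0" "\<And>x. norm (GR x) \<le> KG * norm x"
    using bounded_clinear_bound[OF bounded_clinear_GR] by blast
  have Q_le: "Q w \<le> KP * KG * (norm w)\<^sup>2" for w
  proof -
    have "Q w \<le> cmod (cinner (P w) (GR w))"
      unfolding Q_def by (rule complex_Re_le_cmod)
    also have "\<dots> \<le> (KP * norm w) * (KG * norm w)"
      by (rule order_trans[OF cinner_Cauchy_Schwarz mult_mono[OF KP(2) KG(2)]]) (use KP in auto)
    finally show ?thesis by (simp add: power2_eq_square mult_ac)
  qed
  have "cmod (cinner (P x) (GR w)) \<le> sqrt (KP * KG) * sqrt (Q x) * norm w" for x w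
  proof (rule power2_le_imp_le)
    have "(cmod (cinner (P x) (GR w)))\<^sup>2 \<le> Q x * (KP * KG * (norm w)\<^sup>2)"
      using form_Cauchy_Schwarz mult_left_mono[OF Q_le Q_nonneg] order_trans by blast
    also have "\<dots> = (sqrt (KP * KG) * sqrt (Q x) * norm w)\<^sup>2"
      using KP KG Q_nonneg by (simp add: power_mult_distrib)
    finally show "(cmod (cinner (P x) (GR w)))\<^sup>2 \<le> (sqrt (KP * KG) * sqrt (Q x) * norm w)\<^sup>2" .
  qed (use KP KG Q_nonneg in auto)
  then show ?thesis
    using KP KG by (intro exI[of _ "sqrt (KP * KG)"]) auto
qed

text \<open>Test \<open>GR x\<close> against \<open>w\<close>. First \<open>dual_approx\<close> at
  \<open>y = R\<^sup>d x\<close> replaces \<open>w\<close> by \<open>R\<^sup>d w\<close>; then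
  \<open>G\<close> is moved across, \<open>P_approx\<close> replaces \<open>p(l) R\<^sup>d x\<close>
  by \<open>P x\<close>, and \<open>form_bound\<close> applies.\<close>

lemma GR_estimate:
  "\<exists>C\<ge>0. \<forall>l x. cmod l \<le> M \<longrightarrow> x \<in> dom T \<longrightarrow>
     cmod (pc l) * norm (GR x) \<le> C * (sqrt (Q x) + norm (defect l x))"
proof -
  obtain C1 where C1: "C1 \<ge> 0" "\<And>x w. cmod (cinner (P x) (GR w)) \<le> C1 * sqrt (Q x) * norm w"
    using form_bound by blast
  obtain C2 where C2: "C2 \<ge> 0" "\<And>l x. cmod l \<le> M \<Longrightarrow> x \<in> dom T \<Longrightarrow>
     norm (P x - pc l *\<^sub>C (R ^^ d) x) \<le> C2 * norm (defect l x)"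
    using P_approx by blast
  obtain C3 where C3: "C3 > 0" "\<And>x. norm (GR x) \<le> C3 * norm x"
    using bounded_clinear_bound[OF bounded_clinear_GR] by blast
  obtain C4 where C4: "C4 \<ge> 0" "\<And>l y w. cmod l \<le> M \<Longrightarrow> y \<in> dom T \<Longrightarrow>
     cmod (cinner (app G y) w - (l - cnj \<mu>) ^ d * cinner (app G y) ((R ^^ d) w))
       \<le> C4 * norm (defect l y) * norm w"
    using dual_approx by blast
  obtain C5 where C5: "C5 > 0" "\<And>x. norm ((R ^^ d) x) \<le> C5 * norm x"
    using bounded_clinear_bound[OF bounded_clinear_funpow[OF bounded_clinear_R]] by blast
  obtain C6 where C6: "C6 \<ge> 0" "\<And>l. cmod l \<le> M \<Longrightarrow> cmod (pc l) \<le> C6"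
    using pc_bounded by blast
  define C7 where "C7 = (\<bar>M\<bar> + cmod \<mu>) ^ d"
  have C7: "C7 \<ge> 0" by (simp add: C7_def)
  define D where "D = C7 * (C1 + C2 * C3) + C6 * (C4 * C5)"
  have D: "D \<ge> 0" using C1(1) C2(1) C3(1) C4(1) C5(1) C6(1) C7 by (simp add: D_def)
  have "cmod (pc l) * norm (GR x) \<le> D * (sqrt (Q x) + norm (defect l x))"
    if l: "cmod l \<le> M" and x: "x \<in> dom T" for l x
  proof -
    let ?y = "(R ^^ d) x" and ?e = "norm (defect l x)" and ?q = "sqrt (Q x)"
    have y: "?y \<in> dom T" by (rule Rn_dom[OF d_pos])
    have Gy: "app G ?y = GR x" by (simp add: GR_def)
    have "cmod (pc l) * cmod (cinner (GR x) w) \<le> D * (?q + ?e) * norm w" for w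
    proof -
      have "pc l * cinner (GR x) ((R ^^ d) w) = cinner (pc l *\<^sub>C ?y) (GR w)"
        using selfadjoint_cinner[OF G dom_T_G(1)[OF y] dom_T_G(1)[OF Rn_dom[OF d_pos, of w]]]
        by (simp add: GR_def cinner_simps)
      also have "\<dots> = cinner (P x) (GR w) - cinner (P x - pc l *\<^sub>C ?y) (GR w)"
        by (simp add: cinner_simps)
      also have "cmod \<dots> \<le> C1 * ?q * norm w + (C2 * ?e) * (C3 * norm w)"
        by (rule order_trans[OF norm_triangle_ineq4 add_mono[OF C1(2)
              order_trans[OF cinner_Cauchy_Schwarz mult_mono[OF C2(2)[OF l x] C3(2)]]]])
          (use C2(1) in auto)
      also have "\<dots> \<le> (C1 + C2 * C3) * (?q + ?e) * norm w"
      proof -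
        have "C1 * ?q * norm w + (C2 * ?e) * (C3 * norm w) = (C1 * ?q + C2 * C3 * ?e) * norm w"
          by (simp add: algebra_simps)
        also have "\<dots> \<le> (C1 + C2 * C3) * (?q + ?e) * norm w"
          using C1(1) C2(1) C3(1) Q_nonneg[of x]
          by (intro mult_right_mono) (auto simp: algebra_simps)
        finally show ?thesis .
      qed
      finally have main: "cmod (pc l * cinner (GR x) ((R ^^ d) w)) \<le> (C1 + C2 * C3) * (?q + ?e) * norm w" .
      have "cmod (l - cnj \<mu>) \<le> \<bar>M\<bar> + cmod \<mu>"
        using norm_triangle_ineq4[of l "cnj \<mu>"] l by simp
      then have "cmod ((l - cnj \<mu>) ^ d) \<le> C7"
        unfolding C7_def norm_power by (rule power_mono) simp
      from mult_mono[OF this main C7 norm_ge_zero]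
      have t1: "cmod (pc l) * cmod ((l - cnj \<mu>) ^ d * cinner (GR x) ((R ^^ d) w))
          \<le> C7 * ((C1 + C2 * C3) * (?q + ?e) * norm w)"
        by (simp add: norm_mult mult_ac)
      have "cmod (cinner (GR x) w - (l - cnj \<mu>) ^ d * cinner (GR x) ((R ^^ d) w))
          \<le> C4 * norm (defect l ?y) * norm w"
        using C4(2)[OF l y] by (simp add: Gy)
      also have "\<dots> \<le> C4 * (C5 * ?e) * norm w"
        unfolding defect_Rn[OF x] by (intro mult_right_mono mult_left_mono C5 C4) auto
      finally have "cmod (pc l) * cmod (cinner (GR x) w - (l - cnj \<mu>) ^ d * cinner (GR x) ((R ^^ d) w))
          \<le> C6 * (C4 * (C5 * ?e) * norm w)"
        by (intro mult_mono C6 l) auto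
      also have "\<dots> = C6 * (C4 * C5) * (?e * norm w)" by simp
      also have "\<dots> \<le> C6 * (C4 * C5) * ((?q + ?e) * norm w)"
        using C6(1) C4(1) C5(1) Q_nonneg[of x] by (intro mult_left_mono mult_right_mono) auto
      finally have t2: "cmod (pc l) * cmod (cinner (GR x) w - (l - cnj \<mu>) ^ d * cinner (GR x) ((R ^^ d) w))
          \<le> C6 * (C4 * C5) * ((?q + ?e) * norm w)" .
      have "cmod (pc l) * cmod (cinner (GR x) w) \<le>
          cmod (pc l) * cmod (cinner (GR x) w - (l - cnj \<mu>) ^ d * cinner (GR x) ((R ^^ d) w))
          + cmod (pc l) * cmod ((l - cnj \<mu>) ^ d * cinner (GR x) ((R ^^ d) w))"
        unfolding distrib_left[symmetric]
        by (intro mult_left_mono) (metis diff_add_cancel norm_triangle_ineq, simp)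
      also note add_mono[OF t2 t1]
      finally show ?thesis by (simp add: D_def algebra_simps)
    qed
    then have "norm (pc l *\<^sub>C GR x) \<le> D * (?q + ?e)"
      using D Q_nonneg[of x]
      by (intro norm_le_if_cinner_le_dense[of UNIV]) (auto simp: cinner_simps norm_mult)
    then show ?thesis by (simp add: norm_scaleC)
  qed
  then show ?thesis using D by blast
qed

text \<open>With \<open>h = (T - l) x\<close> one has
  \<open>A (GR x) = l R\<^sup>d x + R\<^sup>d h\<close> and
  \<open>(GA - \<nu>) (GR x) = (l - \<nu>) GR x + GR h\<close>. Applying the bounded
  \<open>A (GA - \<nu>)\<^sup>-\<^sup>1\<close> to the latter bounds
  \<open>l R\<^sup>d x\<close>.\<close>

lemma Rd_estimate:
  "\<exists>C\<ge>0. \<forall>l x. cmod l \<le> M \<longrightarrow> x \<in> dom T \<longrightarrow>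
     cmod l * norm ((R ^^ d) x) \<le> C * (norm (GR x) + norm (defect l x))"
proof -
  obtain C3 where C3: "C3 > 0" "\<And>x. norm (GR x) \<le> C3 * norm x"
    using bounded_clinear_bound[OF bounded_clinear_GR] by blast
  obtain C5 where C5: "C5 > 0" "\<And>x. norm ((R ^^ d) x) \<le> C5 * norm x"
    using bounded_clinear_bound[OF bounded_clinear_funpow[OF bounded_clinear_R]] by blast
  obtain C8 where C8: "C8 > 0" "\<And>x. norm (app A (resolvent (G \<bullet>\<^sub>o\<^sub>p A) \<nu> x)) \<le> C8 * norm x"
    using bounded_clinear_bound[OF bounded_clinear_app_resolvent[OF G A \<nu>]] by blast
  define D where "D = C8 * (\<bar>M\<bar> + cmod \<nu> + C3) + C5"
  have D: "D \<ge> 0" using C3(1) C5(1) C8(1) by (simp add: D_def)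
  have "cmod l * norm ((R ^^ d) x) \<le> D * (norm (GR x) + norm (defect l x))"
    if l: "cmod l \<le> M" and x: "x \<in> dom T" for l x
  proof -
    let ?y = "(R ^^ d) x" and ?h = "defect l x"
    have y: "?y \<in> dom T" "(R ^^ d) ?h \<in> dom T" by (rule Rn_dom[OF d_pos])+
    have Ty: "app T ?y = l *\<^sub>C ?y + (R ^^ d) ?h"
      using defect_Rn[OF x, where l = l and n = d] by (simp add: algebra_simps)
    then have A_GR: "app A (GR x) = l *\<^sub>C ?y + (R ^^ d) ?h"
      by (simp add: app_op_mult GR_def)
    have GR_dom: "GR x \<in> dom (G \<bullet>\<^sub>o\<^sub>p A)"
      using dom_T_G[OF y(1)] dom_T_G(1)[OF y(2)]
      by (simp add: dom_op_mult A_GR linear_op_add[OF linG] linear_op_scaleC[OF linG]) (simp add: GR_def)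
    have "app (G \<bullet>\<^sub>o\<^sub>p A) (GR x) = l *\<^sub>C GR x + GR ?h"
      using dom_T_G(1)[OF y(1)] dom_T_G(1)[OF y(2)]
      unfolding app_op_mult[of G A] A_GR
      by (simp add: linear_op_add[OF linG] linear_op_scaleC[OF linG] GR_def)
    then have "norm (app (G \<bullet>\<^sub>o\<^sub>p A) (GR x) - \<nu> *\<^sub>C GR x) = norm ((l - \<nu>) *\<^sub>C GR x + GR ?h)"
      by (simp add: scaleC_simps algebra_simps)
    also have "\<dots> \<le> (\<bar>M\<bar> + cmod \<nu>) * norm (GR x) + C3 * norm ?h"
    proof (rule norm_triangle_mono[OF _ C3(2)])
      have "cmod (l - \<nu>) \<le> \<bar>M\<bar> + cmod \<nu>"
        using norm_triangle_ineq4[of l \<nu>] l by linarith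
      then show "norm ((l - \<nu>) *\<^sub>C GR x) \<le> (\<bar>M\<bar> + cmod \<nu>) * norm (GR x)"
        unfolding norm_scaleC by (rule mult_right_mono) simp
    qed
    finally have "norm (app A (GR x)) \<le> C8 * ((\<bar>M\<bar> + cmod \<nu>) * norm (GR x) + C3 * norm ?h)"
      using C8(2)[of "app (G \<bullet>\<^sub>o\<^sub>p A) (GR x) - \<nu> *\<^sub>C GR x"] C8(1)
      unfolding resolvent_app[OF \<nu> GR_dom]
      by (meson mult_left_mono order_less_imp_le order_trans)
    moreover have "norm (l *\<^sub>C ?y) \<le> norm (app A (GR x)) + C5 * norm ?h"
    proof -
      have "l *\<^sub>C ?y = app A (GR x) - (R ^^ d) ?h" by (simp add: A_GR)
      then show ?thesis
        using norm_triangle_ineq4[of "app A (GR x)" "(R ^^ d) ?h"] C5(2)[of ?h] by simp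
    qed
    ultimately have "norm (l *\<^sub>C ?y) \<le> C8 * ((\<bar>M\<bar> + cmod \<nu>) * norm (GR x) + C3 * norm ?h) + C5 * norm ?h"
      by linarith
    also have "\<dots> \<le> D * (norm (GR x) + norm ?h)"
      using C3(1) C5(1) C8(1) by (simp add: D_def algebra_simps)
    finally show ?thesis by (simp add: norm_scaleC)
  qed
  then show ?thesis using D by blast
qed

lemma norm_estimate:
  "\<exists>C\<ge>0. \<forall>l x. cmod l \<le> M \<longrightarrow> x \<in> dom T \<longrightarrow>
     norm x \<le> C * (norm ((R ^^ d) x) + norm (defect l x))"
proof -
  obtain C where C: "C \<ge> 0" "\<And>l x. cmod l \<le> M \<Longrightarrow> x \<in> dom T \<Longrightarrow>
     norm (x - (l - \<mu>) ^ d *\<^sub>C (R ^^ d) x) \<le> C * norm (defect l x)"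
    using Rn_approx[of "\<lambda>x. x" M d] bounded_clinear_R by blast
  define D where "D = (\<bar>M\<bar> + cmod \<mu>) ^ d + C"
  have "norm x \<le> D * (norm ((R ^^ d) x) + norm (defect l x))" if l: "cmod l \<le> M" and x: "x \<in> dom T" for l x
  proof -
    have "cmod (l - \<mu>) \<le> \<bar>M\<bar> + cmod \<mu>"
      using norm_triangle_ineq4[of l \<mu>] l by linarith
    then have "norm ((l - \<mu>) ^ d *\<^sub>C (R ^^ d) x) \<le> (\<bar>M\<bar> + cmod \<mu>) ^ d * norm ((R ^^ d) x)"
      unfolding norm_scaleC norm_power by (intro mult_right_mono power_mono) auto
    from norm_triangle_mono[OF C(2)[OF l x] this]
    have "norm x \<le> C * norm (defect l x) + (\<bar>M\<bar> + cmod \<mu>) ^ d * norm ((R ^^ d) x)" by simp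
    also have "\<dots> \<le> D * (norm ((R ^^ d) x) + norm (defect l x))"
      using C(1) by (simp add: D_def algebra_simps)
    finally show ?thesis .
  qed
  moreover have "D \<ge> 0" using C(1) by (simp add: D_def)
  ultimately show ?thesis by blast
qed

text \<open>Chains the three preceding estimates; the defect terms met on the way are absorbed since
  \<open>pc l\<close> and \<open>l\<close> are bounded on \<open>cmod l \<le> M\<close>. The factor
  \<open>cmod l\<close> is why the point 0 is excluded from the statements on real spectrum.\<close>

lemma key_estimate:
  "\<exists>C\<ge>0. \<forall>l x. cmod l \<le> M \<longrightarrow> x \<in> dom T \<longrightarrow>
     cmod (pc l) * cmod l * norm x \<le> C * (sqrt (Q x) + norm (defect l x))"
proof -
  obtain C1 where C1: "C1 \<ge> 0" "\<And>l x. cmod l \<le> M \<Longrightarrow> x \<in> dom T \<Longrightarrow>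
     cmod (pc l) * norm (GR x) \<le> C1 * (sqrt (Q x) + norm (defect l x))"
    using GR_estimate by blast
  obtain C2 where C2: "C2 \<ge> 0" "\<And>l x. cmod l \<le> M \<Longrightarrow> x \<in> dom T \<Longrightarrow>
     cmod l * norm ((R ^^ d) x) \<le> C2 * (norm (GR x) + norm (defect l x))"
    using Rd_estimate by blast
  obtain C3 where C3: "C3 \<ge> 0" "\<And>l x. cmod l \<le> M \<Longrightarrow> x \<in> dom T \<Longrightarrow>
     norm x \<le> C3 * (norm ((R ^^ d) x) + norm (defect l x))"
    using norm_estimate by blast
  obtain C6 where C6: "C6 \<ge> 0" "\<And>l. cmod l \<le> M \<Longrightarrow> cmod (pc l) \<le> C6"
    using pc_bounded by blast
  define D where "D = C3 * (C2 * (C1 + C6) + C6 * \<bar>M\<bar>)"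
  have "cmod (pc l) * cmod l * norm x \<le> D * (sqrt (Q x) + norm (defect l x))"
    if l: "cmod l \<le> M" and x: "x \<in> dom T" for l x
  proof -
    let ?e = "norm (defect l x)" and ?y = "norm ((R ^^ d) x)" and ?q = "sqrt (Q x)"
    have q: "0 \<le> ?q" using Q_nonneg by simp
    have pe: "cmod (pc l) * ?e \<le> C6 * (?q + ?e)"
      using q by (intro mult_mono C6 l) auto
    have "cmod (pc l) * (cmod l * ?y) \<le> cmod (pc l) * (C2 * (norm (GR x) + ?e))"
      by (intro mult_left_mono C2 l x) simp
    also have "\<dots> = C2 * (cmod (pc l) * norm (GR x) + cmod (pc l) * ?e)"
      by (simp add: algebra_simps)
    also have "\<dots> \<le> C2 * (C1 * (?q + ?e) + C6 * (?q + ?e))"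
      by (intro mult_left_mono add_mono C1 C2 l x pe)
    finally have y: "cmod (pc l) * (cmod l * ?y) \<le> C2 * (C1 + C6) * (?q + ?e)"
      by (simp add: algebra_simps)
    have e: "cmod l * (cmod (pc l) * ?e) \<le> \<bar>M\<bar> * (C6 * (?q + ?e))"
      using l by (intro mult_mono pe) auto
    have "cmod (pc l) * cmod l * norm x \<le> cmod (pc l) * cmod l * (C3 * (?y + ?e))"
      by (intro mult_left_mono C3 l x) simp
    also have "\<dots> = C3 * (cmod (pc l) * (cmod l * ?y) + cmod l * (cmod (pc l) * ?e))"
      by (simp add: algebra_simps)
    also have "\<dots> \<le> C3 * (C2 * (C1 + C6) * (?q + ?e) + \<bar>M\<bar> * (C6 * (?q + ?e)))"
      by (intro mult_left_mono add_mono C3 y e)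
    finally show ?thesis by (simp add: D_def algebra_simps)
  qed
  moreover have "D \<ge> 0" using C1(1) C2(1) C3(1) C6(1) by (simp add: D_def)
  ultimately show ?thesis by blast
qed

section \<open>Lower bounds away from the real axis\<close>

lemma Q_approx:
  "\<exists>C\<ge>0. \<forall>l x. cmod l \<le> M \<longrightarrow> x \<in> dom T \<longrightarrow>
     cmod (of_real (Q x) - pc l * cinner ((R ^^ d) x) (GR x)) \<le> C * norm (defect l x) * norm x"
proof -
  obtain C2 where C2: "C2 \<ge> 0" "\<And>l x. cmod l \<le> M \<Longrightarrow> x \<in> dom T \<Longrightarrow>
     norm (P x - pc l *\<^sub>C (R ^^ d) x) \<le> C2 * norm (defect l x)"
    using P_approx by blast
  obtain C3 where C3: "C3 > 0" "\<And>x. norm (GR x) \<le> C3 * norm x"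
    using bounded_clinear_bound[OF bounded_clinear_GR] by blast
  have "cmod (of_real (Q x) - pc l * cinner ((R ^^ d) x) (GR x)) \<le> C2 * C3 * norm (defect l x) * norm x"
    if l: "cmod l \<le> M" and x: "x \<in> dom T" for l x
  proof -
    have "of_real (Q x) = cinner (P x) (GR x)"
      using form_real[of x] by (simp add: complex_eq_iff Q_def)
    then have "of_real (Q x) - pc l * cinner ((R ^^ d) x) (GR x) = cinner (P x - pc l *\<^sub>C (R ^^ d) x) (GR x)"
      by (simp add: cinner_simps)
    also have "cmod \<dots> \<le> (C2 * norm (defect l x)) * (C3 * norm x)"
      by (rule order_trans[OF cinner_Cauchy_Schwarz mult_mono[OF C2(2)[OF l x] C3(2)]])
        (use C2(1) in auto)
    finally show ?thesis by (simp add: mult_ac)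
  qed
  then show ?thesis
    using C2(1) C3(1) by (intro exI[of _ "C2 * C3"]) auto
qed

text \<open>For \<open>y = R\<^sup>d x\<close> both \<open>(Ty, Gy)\<close> and
  \<open>(y, Gy)\<close> are real by symmetry. Since \<open>Ty = l y + R\<^sup>d h\<close> with
  \<open>h\<close> the defect, the term \<open>2 Im l (y, Gy)\<close> is balanced by terms
  containing \<open>h\<close>.\<close>

lemma cinner_Rd_GR_bound:
  "\<exists>C\<ge>0. \<forall>l x. x \<in> dom T \<longrightarrow>
     \<bar>Im l\<bar> * cmod (cinner ((R ^^ d) x) (GR x)) \<le> C * norm (defect l x) * norm x"
proof -
  obtain C3 where C3: "C3 > 0" "\<And>x. norm (GR x) \<le> C3 * norm x"
    using bounded_clinear_bound[OF bounded_clinear_GR] by blast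
  obtain C5 where C5: "C5 > 0" "\<And>x. norm ((R ^^ d) x) \<le> C5 * norm x"
    using bounded_clinear_bound[OF bounded_clinear_funpow[OF bounded_clinear_R]] by blast
  have "\<bar>Im l\<bar> * cmod (cinner ((R ^^ d) x) (GR x)) \<le> C3 * C5 * norm (defect l x) * norm x"
    if x: "x \<in> dom T" for l x
  proof -
    let ?y = "(R ^^ d) x" and ?h = "(R ^^ d) (defect l x)"
    have y: "?y \<in> dom T" by (rule Rn_dom[OF d_pos])
    have Ty: "app T ?y = l *\<^sub>C ?y + ?h"
      using defect_Rn[OF x, where l = l and n = d] by (simp add: algebra_simps)
    have sym: "cinner (GR x) ?y = cinner ?y (GR x)"
      unfolding GR_def by (rule selfadjoint_cinner[OF G]) (rule dom_T_G(1)[OF y])+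
    have "cinner (l *\<^sub>C ?y + ?h) (GR x) = cinner (GR x) (l *\<^sub>C ?y + ?h)"
      using T_symmetric[OF y y] unfolding Ty GR_def .
    then have "(l - cnj l) * cinner ?y (GR x) = cinner (GR x) ?h - cinner ?h (GR x)"
      by (simp add: cinner_simps sym algebra_simps)
    then have "cmod (l - cnj l) * cmod (cinner ?y (GR x)) = cmod (cinner (GR x) ?h - cinner ?h (GR x))"
      by (metis norm_mult)
    also have "\<dots> \<le> norm (GR x) * norm ?h + norm ?h * norm (GR x)"
      by (intro order_trans[OF norm_triangle_ineq4] add_mono cinner_Cauchy_Schwarz)
    finally have "\<bar>Im l\<bar> * cmod (cinner ?y (GR x)) \<le> norm (GR x) * norm ?h"
      by (simp add: complex_diff_cnj norm_mult)
    also have "\<dots> \<le> (C3 * norm x) * (C5 * norm (defect l x))"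
      by (intro mult_mono C3 C5) (use C3(1) in auto)
    finally show ?thesis by (simp add: mult_ac)
  qed
  then show ?thesis
    using C3(1) C5(1) by (intro exI[of _ "C3 * C5"]) auto
qed

text \<open>With \<open>e\<close> the norm of the defect, \<open>Q x = O(e * norm x)\<close>, so the
  key estimate becomes \<open>cmod (pc l) * norm x \<le> K * sqrt (e * norm x)\<close>. Squaring and
  dividing by \<open>norm x\<close> explains the square of \<open>pc l\<close>.\<close>

lemma nonreal_lower_bound:
  assumes \<delta>: "0 < \<delta>"
  shows "\<exists>c>0. \<forall>l x. cmod l \<le> M \<longrightarrow> \<delta> \<le> \<bar>Im l\<bar> \<longrightarrow> x \<in> dom T \<longrightarrow>
     c * (cmod (pc l))\<^sup>2 * norm x \<le> norm (defect l x)"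
proof -
  obtain C1 where C1: "C1 \<ge> 0" "\<And>l x. x \<in> dom T \<Longrightarrow>
     \<bar>Im l\<bar> * cmod (cinner ((R ^^ d) x) (GR x)) \<le> C1 * norm (defect l x) * norm x"
    using cinner_Rd_GR_bound by blast
  obtain C2 where C2: "C2 \<ge> 0" "\<And>l x. cmod l \<le> M \<Longrightarrow> x \<in> dom T \<Longrightarrow>
     cmod (of_real (Q x) - pc l * cinner ((R ^^ d) x) (GR x)) \<le> C2 * norm (defect l x) * norm x"
    using Q_approx by blast
  obtain C3 where C3: "C3 \<ge> 0" "\<And>l x. cmod l \<le> M \<Longrightarrow> x \<in> dom T \<Longrightarrow>
     cmod (pc l) * cmod l * norm x \<le> C3 * (sqrt (Q x) + norm (defect l x))"
    using key_estimate by blast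
  obtain C6 where C6: "C6 \<ge> 0" "\<And>l. cmod l \<le> M \<Longrightarrow> cmod (pc l) \<le> C6"
    using pc_bounded by blast
  define C9 where "C9 = C6 * (C1 / \<delta>) + C2"
  have C9: "C9 \<ge> 0" using C1(1) C2(1) C6(1) \<delta> by (simp add: C9_def)
  define K where "K = C3 * (sqrt C9 + 1) / \<delta>"
  have K: "K \<ge> 0" using C3(1) C9 \<delta> by (simp add: K_def)
  \<comment> \<open>\<open>K\<^sup>2\<close> serves the main case \<open>e \<le> norm x\<close>,
    \<open>C6\<^sup>2\<close> the trivial case \<open>norm x < e\<close>, and 1 makes
    \<open>D\<close> positive.\<close>
  define D where "D = K\<^sup>2 + C6\<^sup>2 + 1"
  have D: "D > 0" by (simp add: D_def add_nonneg_pos)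
  have "(cmod (pc l))\<^sup>2 * norm x \<le> D * norm (defect l x)"
    if l: "cmod l \<le> M" "\<delta> \<le> \<bar>Im l\<bar>" and x: "x \<in> dom T" for l x
  proof -
    define e where "e = norm (defect l x)"
    have e: "e \<ge> 0" by (simp add: e_def)
    show ?thesis
    proof (cases "norm x < e")
      case True
      have "(cmod (pc l))\<^sup>2 * norm x \<le> C6\<^sup>2 * e"
        using True by (intro mult_mono power_mono C6 l) auto
      also have "\<dots> \<le> D * e"
        using e by (intro mult_right_mono) (auto simp: D_def)
      finally show ?thesis by (simp add: e_def)
    next
      case False
      then have ex: "e \<le> norm x" by simp
      let ?b = "cinner ((R ^^ d) x) (GR x)"
      have "\<delta> * cmod ?b \<le> \<bar>Im l\<bar> * cmod ?b"
        using l(2) by (rule mult_right_mono) simp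
      also note C1(2)[OF x, of l]
      finally have b: "cmod ?b \<le> C1 / \<delta> * (e * norm x)"
        using \<delta> by (simp add: field_simps e_def)
      have "Q x = cmod ((of_real (Q x) - pc l * ?b) + pc l * ?b)"
        using Q_nonneg[of x] by simp
      also have "\<dots> \<le> C2 * e * norm x + C6 * (C1 / \<delta> * (e * norm x))"
        unfolding e_def
        by (rule norm_triangle_mono[OF C2(2)[OF l(1) x]], unfold norm_mult, rule mult_mono)
          (use b C6 l in \<open>auto simp: e_def\<close>)
      also have "\<dots> = C9 * (e * norm x)" by (simp add: C9_def algebra_simps)
      finally have "sqrt (Q x) \<le> sqrt C9 * sqrt (e * norm x)"
        by (metis real_sqrt_le_iff real_sqrt_mult)
      moreover have "e \<le> sqrt (e * norm x)"
        using ex e by (intro real_le_rsqrt) (auto simp: power2_eq_square intro: mult_left_mono)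
      ultimately have "sqrt (Q x) + e \<le> (sqrt C9 + 1) * sqrt (e * norm x)"
        by (simp add: algebra_simps)
      then have "C3 * (sqrt (Q x) + e) \<le> C3 * ((sqrt C9 + 1) * sqrt (e * norm x))"
        using C3(1) by (rule mult_left_mono)
      then have key: "cmod (pc l) * cmod l * norm x \<le> C3 * ((sqrt C9 + 1) * sqrt (e * norm x))"
        using C3(2)[OF l(1) x] unfolding e_def by linarith
      have "\<delta> \<le> cmod l" using l(2) abs_Im_le_cmod[of l] by linarith
      then have "\<delta> * (cmod (pc l) * norm x) \<le> cmod l * (cmod (pc l) * norm x)"
        by (rule mult_right_mono) simp
      with key have "\<delta> * (cmod (pc l) * norm x) \<le> C3 * ((sqrt C9 + 1) * sqrt (e * norm x))"
        by (simp add: mult_ac)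
      then have "cmod (pc l) * norm x \<le> K * sqrt (e * norm x)"
        using \<delta> by (simp add: K_def field_simps)
      then have "(cmod (pc l) * norm x)\<^sup>2 \<le> (K * sqrt (e * norm x))\<^sup>2"
        by (rule power_mono) simp
      then have "norm x * ((cmod (pc l))\<^sup>2 * norm x) \<le> norm x * (K\<^sup>2 * e)"
        using e by (simp add: power_mult_distrib power2_eq_square mult_ac)
      then have "(cmod (pc l))\<^sup>2 * norm x \<le> K\<^sup>2 * e"
        using e by (cases "norm x = 0") auto
      also have "\<dots> \<le> D * e"
        using e by (intro mult_right_mono) (auto simp: D_def)
      finally show ?thesis by (simp add: e_def)
    qed
  qed
  then show ?thesis
    using D by (intro exI[of _ "1 / D"]) (auto simp: field_simps)
qed

section \<open>The nonreal spectrum\<close>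

lemma finite_zeros: "finite {l. pc l = 0}"
proof -
  have "p \<noteq> 0" using p by (simp add: definitizing_def)
  then have "map_poly complex_of_real p \<noteq> 0" by (simp add: map_poly_eq_0_iff)
  then show ?thesis by (rule poly_roots_finite)
qed

text \<open>The half plane without the finitely many zeros is connected. Inside it both
  \<open>rho T\<close> and its complement are open, and \<open>rho T\<close> occurs, so it is
  everything.\<close>

lemma rho_upper_half_plane: "{l. 0 < Im l} - {l. pc l = 0} \<subseteq> rho T"
proof -
  let ?H = "{l. 0 < Im l}" and ?Z = "{l. pc l = 0}"
  have openH: "open ?H" by (rule open_halfspace_Im_gt)
  have openU: "open (?H - ?Z)"
    by (intro open_Diff openH finite_imp_closed finite_zeros)
  have conn: "connected (?H - ?Z)"
    by (intro connected_open_diff_countable openH convex_connected convex_halfspace_Im_gt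
        countable_finite finite_zeros) simp
  have openB: "open ((?H - ?Z) - rho T)"
  proof (rule openI)
    fix l assume l: "l \<in> (?H - ?Z) - rho T"
    obtain c where c: "c > 0" "\<And>x. x \<in> dom T \<Longrightarrow> c * (cmod (pc l))\<^sup>2 * norm x \<le> norm (defect l x)"
      using nonreal_lower_bound[of "Im l" "cmod l"] l by auto
    let ?c = "c * (cmod (pc l))\<^sup>2"
    have c': "?c > 0" using c(1) l by simp
    \<comment> \<open>Were such an \<open>m\<close> in \<open>rho T\<close>, the lower bound at
      \<open>l\<close> would put \<open>l\<close> into \<open>rho T\<close> as well.\<close>
    have away: "m \<notin> rho T" if "dist l m < ?c / 2" for m
      using rho_if_bounded_below_near_rho[OF linT c' c(2), of m] l that by (auto simp: dist_norm)
    obtain r where r: "r > 0" "ball l r \<subseteq> ?H - ?Z"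
      using openU l by (meson DiffD1 open_contains_ball)
    show "\<exists>r>0. ball l r \<subseteq> (?H - ?Z) - rho T"
      using r away c' by (intro exI[of _ "min r (?c / 2)"]) (auto simp: subset_iff)
  qed
  have open_rhoT: "open (rho T)" by (rule open_rho[OF linT])
  have "rho T \<inter> ?H \<noteq> {}"
  proof -
    obtain r where r: "r > 0" "ball \<mu> r \<subseteq> rho T"
      using open_rhoT \<mu> by (meson open_contains_ball)
    \<comment> \<open>The shift points away from the real axis, so \<open>m\<close> is nonreal even
      if \<open>\<mu>\<close> is real; either \<open>m\<close> or its conjugate is then in the upper
      half plane.\<close>
    define t where "t = (if Im \<mu> < 0 then - r / 2 else r / 2)"
    define m where "m = \<mu> + \<i> * of_real t"
    have "m \<in> rho T" using r by (intro subsetD[OF r(2)]) (auto simp: m_def t_def dist_norm norm_mult)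
    have Im_m: "Im m \<noteq> 0" using r(1) by (auto simp: m_def t_def)
    then have "m \<noteq> 0" by auto
    have "cnj m \<in> rho T" by (rule cnj_rho[OF A G \<open>m \<in> rho T\<close> \<open>m \<noteq> 0\<close> \<nu>])
    then show ?thesis
      using \<open>m \<in> rho T\<close> Im_m by (cases "Im m > 0") auto
  qed
  \<comment> \<open>A nonempty open set is infinite and so not exhausted by the zeros.\<close>
  then have "infinite (rho T \<inter> ?H)"
    using finite_imp_not_open open_Int[OF open_rhoT openH] by blast
  then have meets: "rho T \<inter> (?H - ?Z) \<noteq> {}"
    using finite_subset[OF _ finite_zeros, of "rho T \<inter> ?H"] by blast
  have "rho T \<inter> (?H - ?Z) = {} \<or> ((?H - ?Z) - rho T) \<inter> (?H - ?Z) = {}"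
    by (rule connectedD[OF conn open_rhoT openB]) auto
  with meets show ?thesis by blast
qed

lemma pc_cnj: "pc (cnj l) = cnj (pc l)"
  by (simp add: pc_eq)

lemma nonreal_in_rho: "l \<notin> \<real> \<Longrightarrow> pc l \<noteq> 0 \<Longrightarrow> l \<in> rho T"
proof -
  assume l: "l \<notin> \<real>" "pc l \<noteq> 0"
  then have "Im l \<noteq> 0" by (simp add: complex_is_Real_iff)
  then consider "Im l > 0" | "Im l < 0" by linarith
  then show ?thesis
  proof cases
    case 1
    then show ?thesis using rho_upper_half_plane l by blast
  next
    case 2
    then have "cnj l \<in> rho T" using rho_upper_half_plane l by (auto simp: pc_cnj)
    moreover have "cnj l \<noteq> 0" using 2 by auto
    ultimately show ?thesis using cnj_rho[OF A G _ _ \<nu>, of "cnj l"] by simp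
  qed
qed

text \<open>Near \<open>l\<close> the polynomial behaves like \<open>(z - l) ^ m\<close> with
  \<open>m\<close> the order of the zero. The lower bound is quadratic in \<open>pc z\<close>, so
  the resolvent grows at most like the power \<open>2 * m\<close> of
  \<open>1 / cmod (z - l)\<close>.\<close>

lemma resolvent_pole_nonreal:
  assumes l: "l \<in> spec T" "l \<notin> \<real>"
  shows "resolvent_pole T l"
proof -
  let ?p = "map_poly complex_of_real p"
  have "p \<noteq> 0" using p by (simp add: definitizing_def)
  then have p0: "?p \<noteq> 0" by (simp add: map_poly_eq_0_iff)
  define m where "m = order l ?p"
  obtain q where q: "?p = [:- l, 1:] ^ m * q" "\<not> [:- l, 1:] dvd q"
    using order_decomp[OF p0, of l] unfolding m_def by blast
  have ql: "poly q l \<noteq> 0" using q(2) by (simp add: poly_eq_0_iff_dvd)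
  have pc_q: "cmod (pc z) = cmod (z - l) ^ m * cmod (poly q z)" for z
    unfolding q(1) by (simp add: norm_mult norm_power)
  define b where "b = cmod (poly q l) / 2"
  have b: "b > 0" using ql by (simp add: b_def)
  have "isCont (poly q) l" by simp
  then obtain r where r: "r > 0" "\<And>z. dist z l < r \<Longrightarrow> dist (poly q z) (poly q l) < b"
    using b unfolding continuous_at_eps_delta by (metis dist_norm)
  have qz: "b < cmod (poly q z)" if "cmod (z - l) < r" for z
    using r(2)[of z] that norm_triangle_ineq2[of "poly q l" "poly q z"]
    by (simp add: b_def dist_norm norm_minus_commute)
  \<comment> \<open>Half the distance to the real axis, so that one constant of
    \<open>nonreal_lower_bound\<close> serves the whole disc.\<close>
  define \<delta> where "\<delta> = \<bar>Im l\<bar> / 2"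
  have \<delta>: "\<delta> > 0" using l(2) by (simp add: \<delta>_def complex_is_Real_iff)
  define \<epsilon> where "\<epsilon> = min r \<delta>"
  have \<epsilon>: "\<epsilon> > 0" using r(1) \<delta> by (simp add: \<epsilon>_def)
  obtain c where c: "c > 0" "\<And>z x. cmod z \<le> cmod l + \<epsilon> \<Longrightarrow> \<delta> \<le> \<bar>Im z\<bar> \<Longrightarrow> x \<in> dom T \<Longrightarrow>
     c * (cmod (pc z))\<^sup>2 * norm x \<le> norm (defect z x)"
    using nonreal_lower_bound[OF \<delta>, of "cmod l + \<epsilon>"] by blast
  have "z \<in> rho T \<and> (\<forall>y. norm (resolvent T z y) \<le> 1 / (c * b\<^sup>2) / cmod (z - l) ^ (2 * m) * norm y)"
    if z: "0 < cmod (z - l)" "cmod (z - l) < \<epsilon>" for z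
  proof -
    have "\<bar>Im (z - l)\<bar> < \<delta>" using abs_Im_le_cmod[of "z - l"] z(2) by (simp add: \<epsilon>_def)
    then have Imz: "\<delta> \<le> \<bar>Im z\<bar>" unfolding \<delta>_def minus_complex.sel by linarith
    have normz: "cmod z \<le> cmod l + \<epsilon>"
      using norm_triangle_ineq2[of z l] z(2) by linarith
    have bq: "b < cmod (poly q z)" using qz z(2) by (simp add: \<epsilon>_def)
    have "pc z \<noteq> 0" using pc_q[of z] bq b z(1) by auto
    moreover have "z \<notin> \<real>" using Imz \<delta> by (auto simp: complex_is_Real_iff)
    ultimately have rho: "z \<in> rho T" by (intro nonreal_in_rho)
    let ?w = "cmod (z - l) ^ (2 * m)"
    have w: "?w > 0" using z(1) by simp
    have "b\<^sup>2 * ?w \<le> (cmod (pc z))\<^sup>2"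
      unfolding pc_q power_mult_distrib power_even_eq mult.commute[of "b\<^sup>2"]
      using bq b by (intro mult_left_mono power_mono) auto
    then have le: "c * b\<^sup>2 * ?w \<le> c * (cmod (pc z))\<^sup>2"
      using c(1) by (simp add: mult.assoc)
    have "c * b\<^sup>2 * ?w * norm x \<le> norm (defect z x)" if "x \<in> dom T" for x
      using order_trans[OF mult_right_mono[OF le norm_ge_zero] c(2)[OF normz Imz that]] .
    then have "norm (resolvent T z y) \<le> 1 / (c * b\<^sup>2 * ?w) * norm y" for y
      by (intro norm_resolvent_le[OF rho]) (use c(1) b w in auto)
    then show ?thesis using rho by (simp add: divide_divide_eq_left)
  qed
  then show ?thesis
    unfolding resolvent_pole_def using l(1) \<epsilon> by blast
qed

section \<open>The real spectrum and the sign of the form\<close>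

lemma real_spec_sigma_ap:
  assumes l: "l \<in> spec T" "l \<in> \<real>" and pl: "pc l \<noteq> 0"
  shows "l \<in> sigma_ap T"
proof (rule ccontr)
  assume not_ap: "l \<notin> sigma_ap T"
  \<comment> \<open>Without such a \<open>c\<close>, normalizing vectors that violate the bounds
    \<open>1 / Suc n\<close> would produce an approximate eigensequence.\<close>
  have "\<exists>c>0. \<forall>x\<in>dom T. c * norm x \<le> norm (defect l x)"
  proof (rule ccontr)
    assume "\<not> ?thesis"
    then have "\<exists>x\<in>dom T. norm (defect l x) < 1 / Suc n * norm x" for n :: nat
      by (meson not_le of_nat_0_less_iff zero_less_Suc zero_less_divide_1_iff)
    then obtain X where X: "\<And>n::nat. X n \<in> dom T" "\<And>n. norm (defect l (X n)) < 1 / Suc n * norm (X n)"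
      by metis
    have pos: "norm (X n) > 0" for n
      using X(2)[of n] by (smt (verit) divide_nonneg_nonneg mult_eq_0_iff norm_ge_zero)
    define Y where "Y n = complex_of_real (1 / norm (X n)) *\<^sub>C X n" for n
    have Y: "Y n \<in> dom T" "norm (Y n) = 1" for n
      using X(1) pos[of n] by (simp_all add: Y_def linear_op_scaleC[OF linT] norm_scaleC norm_divide)
    have "norm (defect l (Y n)) \<le> 1 / Suc n" for n
    proof -
      have "defect l (Y n) = complex_of_real (1 / norm (X n)) *\<^sub>C defect l (X n)"
        by (simp add: Y_def linear_op_scaleC[OF linT X(1)] scaleC_simps mult.commute)
      then have "norm (defect l (Y n)) = norm (defect l (X n)) / norm (X n)"
        by (simp add: norm_scaleC norm_divide)
      then show ?thesis using X(2)[of n] pos[of n] by (simp only: pos_divide_le_eq)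
    qed
    then have "(\<lambda>n. defect l (Y n)) \<longlonglongrightarrow> 0"
      by (intro Lim_null_comparison[OF _ LIMSEQ_Suc[OF lim_1_over_n]]) auto
    then have "l \<in> sigma_ap T"
      unfolding sigma_ap_def using Y by blast
    with not_ap show False by blast
  qed
  then obtain c where c: "c > 0" "\<And>x. x \<in> dom T \<Longrightarrow> c * norm x \<le> norm (defect l x)" by blast
  have "isCont pc l" by simp
  then obtain r where r: "r > 0" "\<And>z. dist z l < r \<Longrightarrow> dist (pc z) (pc l) < cmod (pc l)"
    using pl unfolding continuous_at_eps_delta by (metis dist_norm zero_less_norm_iff)
  \<comment> \<open>A nonreal \<open>z\<close> above \<open>l\<close>, close enough for
    \<open>pc z \<noteq> 0\<close>, hence \<open>z \<in> rho T\<close>, and within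
    \<open>c / 2\<close>, so that the lower bound carries \<open>l\<close> into
    \<open>rho T\<close>.\<close>
  define t where "t = min r (c / 2) / 2"
  define z where "z = l + \<i> * of_real t"
  have t: "t > 0" "t < r" "t < c / 2" using r(1) c(1) by (auto simp: t_def min_def)
  have dist: "cmod (l - z) = t" using t(1) by (simp add: z_def norm_mult)
  then have "dist (pc z) (pc l) < cmod (pc l)"
    using r(2)[of z] t by (simp add: dist_norm norm_minus_commute)
  then have "pc z \<noteq> 0" by (auto simp: dist_norm)
  moreover have "z \<notin> \<real>" using l(2) t(1) by (auto simp: z_def complex_is_Real_iff)
  ultimately have "z \<in> rho T" by (intro nonreal_in_rho)
  then have "l \<in> rho T"
    using rho_if_bounded_below_near_rho[OF linT c] dist t by simp
  then show False using l(1) by (simp add: spec_def)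
qed

text \<open>Connects the form at \<open>R x\<close>, which will be \<open>[x,x]\<close>, with the
  form at \<open>R\<^sup>d x\<close>, which occurs in \<open>Q\<close>. \<open>Rn_approx\<close> at
  \<open>R x\<close> with power \<open>d - 1\<close> is applied in both slots; the factors
  \<open>(l - \<mu>) ^ (d - 1)\<close> and its conjugate multiply to a nonnegative number.\<close>

lemma cinner_R_GR_approx:
  "\<exists>C\<ge>0. \<forall>x. x \<in> dom T \<longrightarrow>
     cmod (cinner (R x) (app G (R x)) - of_real ((cmod (l - \<mu>)) ^ (2 * (d - 1))) * cinner ((R ^^ d) x) (GR x))
       \<le> C * norm (defect l x) * norm x"
proof -
  obtain C1 where C1: "C1 \<ge> 0" "\<And>x. x \<in> dom T \<Longrightarrow>
     norm (x - (l - \<mu>) ^ (d - 1) *\<^sub>C (R ^^ (d - 1)) x) \<le> C1 * norm (defect l x)"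
    using Rn_approx[of "\<lambda>x. x" "cmod l" "d - 1"] bounded_clinear_R by blast
  have "app G (x + c *\<^sub>C y) = app G x + c *\<^sub>C app G y" if "x \<in> dom T" "y \<in> dom T" for x y c
    using dom_T_G(1)[OF that(1)] dom_T_G(1)[OF that(2)]
    by (simp add: linear_op_add[OF linG] linear_op_scaleC[OF linG])
  then obtain C2 where C2: "C2 \<ge> 0" "\<And>x. x \<in> dom T \<Longrightarrow>
     norm (app G x - (l - \<mu>) ^ (d - 1) *\<^sub>C app G ((R ^^ (d - 1)) x)) \<le> C2 * norm (defect l x)"
    using Rn_approx[of "app G" "cmod l" "d - 1"] bounded_clinear_app_G_R by blast
  obtain K where K: "K > 0" "\<And>x. norm (R x) \<le> K * norm x"
    using bounded_clinear_bound[OF bounded_clinear_R] by blast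
  obtain K1 where K1: "K1 > 0" "\<And>x. norm (app G (R x)) \<le> K1 * norm x"
    using bounded_clinear_bound[OF bounded_clinear_app_G_R] by blast
  obtain K2 where K2: "K2 > 0" "\<And>x. norm ((R ^^ d) x) \<le> K2 * norm x"
    using bounded_clinear_bound[OF bounded_clinear_funpow[OF bounded_clinear_R]] by blast
  define a where "a = (l - \<mu>) ^ (d - 1)"
  define D where "D = C1 * K * K1 + C2 * K * (cmod a * K2)"
  have "cmod (cinner (R x) (app G (R x)) - of_real ((cmod (l - \<mu>)) ^ (2 * (d - 1))) * cinner ((R ^^ d) x) (GR x))
       \<le> D * norm (defect l x) * norm x" if x: "x \<in> dom T" for x
  proof -
    let ?v = "R x" and ?y = "(R ^^ d) x" and ?e = "norm (defect l x)"
    have y: "(R ^^ (d - 1)) ?v = ?y"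
      using d_pos by (metis Suc_diff_1 comp_apply funpow_Suc_right)
    have "defect l ?v = R (defect l x)"
      using defect_Rn[OF x, where l = l and n = 1] by simp
    then have e: "norm (defect l ?v) \<le> K * ?e" using K(2) by simp
    have e1: "norm (?v - a *\<^sub>C ?y) \<le> C1 * K * ?e"
      using order_trans[OF C1(2)[OF R_dom, of x] mult_left_mono[OF e C1(1)]]
      unfolding y a_def mult.assoc .
    have e2: "norm (app G ?v - a *\<^sub>C GR x) \<le> C2 * K * ?e"
      using order_trans[OF C2(2)[OF R_dom, of x] mult_left_mono[OF e C2(1)]]
      unfolding y a_def mult.assoc GR_def .
    have "of_real ((cmod (l - \<mu>)) ^ (2 * (d - 1))) = a * cnj a"
      unfolding complex_norm_square[symmetric] a_def norm_power power_even_eq power_mult[symmetric]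
      by (simp add: mult.commute)
    then have "cinner ?v (app G ?v) - of_real ((cmod (l - \<mu>)) ^ (2 * (d - 1))) * cinner ?y (GR x)
        = cinner (?v - a *\<^sub>C ?y) (app G ?v) + cinner (a *\<^sub>C ?y) (app G ?v - a *\<^sub>C GR x)"
      by (simp add: cinner_simps algebra_simps)
    also have "cmod \<dots> \<le> (C1 * K * ?e) * (K1 * norm x) + (cmod a * (K2 * norm x)) * (C2 * K * ?e)"
    proof (rule norm_triangle_mono)
      show "cmod (cinner (?v - a *\<^sub>C ?y) (app G ?v)) \<le> (C1 * K * ?e) * (K1 * norm x)"
        by (rule order_trans[OF cinner_Cauchy_Schwarz mult_mono[OF e1 K1(2)]]) (use C1(1) K(1) in auto)
      have "norm (a *\<^sub>C ?y) \<le> cmod a * (K2 * norm x)"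
        unfolding norm_scaleC by (intro mult_left_mono K2) simp
      then show "cmod (cinner (a *\<^sub>C ?y) (app G ?v - a *\<^sub>C GR x)) \<le> (cmod a * (K2 * norm x)) * (C2 * K * ?e)"
        by (intro order_trans[OF cinner_Cauchy_Schwarz] mult_mono e2) (use K2(1) in auto)
    qed
    finally show ?thesis by (simp add: D_def algebra_simps)
  qed
  moreover have "D \<ge> 0" using C1(1) C2(1) K(1) K1(1) K2(1) by (simp add: D_def)
  ultimately show ?thesis by blast
qed

lemma pc_real: "l \<in> \<real> \<Longrightarrow> pc l = of_real (poly p (Re l))"
  by (auto simp: pc_eq poly_altdef[of p] Reals_def)

text \<open>The key estimate keeps \<open>Q (X n)\<close> away from 0, and up to vanishing errors a
  positive multiple of \<open>Q (X n)\<close> is \<open>p(l)\<close> times the form at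
  \<open>R (X n)\<close>. Multiplying by \<open>p(l)\<close> treats both signs at once.\<close>

lemma form_definite:
  assumes l: "l \<in> \<real>" "l \<noteq> 0" "poly p (Re l) \<noteq> 0" and \<mu>_nonreal: "\<mu> \<notin> \<real>"
    and X: "\<And>n. X n \<in> dom T" "\<And>n. norm (X n) = 1" and lim: "(\<lambda>n. defect l (X n)) \<longlonglongrightarrow> 0"
  shows "\<exists>c>0. \<forall>\<^sub>F n in sequentially.
    c \<le> poly p (Re l) * Re (cinner (R (X n)) (app G (R (X n))))"
proof -
  let ?pl = "poly p (Re l)"
  have pcl: "pc l = of_real ?pl" by (rule pc_real[OF l(1)])
  obtain C1 where C1: "C1 \<ge> 0" "\<And>x. x \<in> dom T \<Longrightarrow>
     cmod (pc l) * cmod l * norm x \<le> C1 * (sqrt (Q x) + norm (defect l x))"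
    using key_estimate[of "cmod l"] by blast
  obtain C2 where C2: "C2 \<ge> 0" "\<And>x. x \<in> dom T \<Longrightarrow>
     cmod (of_real (Q x) - pc l * cinner ((R ^^ d) x) (GR x)) \<le> C2 * norm (defect l x) * norm x"
    using Q_approx[of "cmod l"] by blast
  define a where "a = (cmod (l - \<mu>)) ^ (2 * (d - 1))"
  obtain C3 where C3: "C3 \<ge> 0" "\<And>x. x \<in> dom T \<Longrightarrow>
     cmod (cinner (R x) (app G (R x)) - of_real a * cinner ((R ^^ d) x) (GR x))
       \<le> C3 * norm (defect l x) * norm x"
    using cinner_R_GR_approx[of l] unfolding a_def by blast
  \<comment> \<open>Here \<open>\<mu> \<notin> \<real>\<close> enters: the comparison factor
    \<open>a\<close> must not vanish.\<close>
  have "l \<noteq> \<mu>" using l(1) \<mu>_nonreal by auto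
  then have a: "a > 0" by (simp add: a_def)
  define e where "e n = norm (defect l (X n))" for n
  have e: "e \<longlonglongrightarrow> 0" unfolding e_def using lim by (rule tendsto_norm_zero)
  \<comment> \<open>Half of the bound forced on \<open>sqrt (Q (X n)) + e n\<close>; once
    \<open>e n < b\<close>, the other half remains for \<open>sqrt (Q (X n))\<close>. Using
    \<open>C1 + 1\<close> avoids division by zero.\<close>
  define b where "b = \<bar>?pl\<bar> * cmod l / (2 * (C1 + 1))"
  have b: "b > 0" using l C1(1) by (simp add: b_def)
  define K where "K = \<bar>?pl\<bar> * C3 + a * C2"
  have K: "K \<ge> 0" using C2(1) C3(1) a by (simp add: K_def)
  have lower: "a * Q (X n) - K * e n \<le> ?pl * Re (cinner (R (X n)) (app G (R (X n))))" for n
  proof -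
    let ?q = "cinner ((R ^^ d) (X n)) (GR (X n))" and ?v = "cinner (R (X n)) (app G (R (X n)))"
    have "\<bar>Re (?v - of_real a * ?q)\<bar> \<le> C3 * e n"
      using order_trans[OF abs_Re_le_cmod C3(2)[OF X(1)[of n]]] X(2) by (simp add: e_def)
    then have "\<bar>?pl\<bar> * \<bar>Re ?v - a * Re ?q\<bar> \<le> \<bar>?pl\<bar> * (C3 * e n)"
      by (intro mult_left_mono) auto
    then have 1: "\<bar>?pl * Re ?v - a * (?pl * Re ?q)\<bar> \<le> \<bar>?pl\<bar> * C3 * e n"
      by (simp add: abs_mult[symmetric] algebra_simps)
    have "\<bar>Re (of_real (Q (X n)) - pc l * ?q)\<bar> \<le> C2 * e n"
      using order_trans[OF abs_Re_le_cmod C2(2)[OF X(1)[of n]]] X(2) by (simp add: e_def)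
    then have "a * \<bar>Q (X n) - ?pl * Re ?q\<bar> \<le> a * (C2 * e n)"
      using a by (intro mult_left_mono) (auto simp: pcl)
    then have 2: "\<bar>a * Q (X n) - a * (?pl * Re ?q)\<bar> \<le> a * C2 * e n"
      using a by (simp add: abs_mult right_diff_distrib[symmetric])
    have "K * e n = \<bar>?pl\<bar> * C3 * e n + a * C2 * e n" by (simp add: K_def algebra_simps)
    with 1 2 show ?thesis by linarith
  qed
  have "\<forall>\<^sub>F n in sequentially. e n < b"
    using order_tendstoD(2)[OF e b] .
  moreover have "(\<lambda>n. K * e n) \<longlonglongrightarrow> 0"
    using tendsto_mult_right_zero[OF e] .
  then have "\<forall>\<^sub>F n in sequentially. K * e n < a * b\<^sup>2 / 2"
    using a b by (intro order_tendstoD(2)) auto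
  ultimately have "\<forall>\<^sub>F n in sequentially. a * b\<^sup>2 / 2 \<le> ?pl * Re (cinner (R (X n)) (app G (R (X n))))"
  proof eventually_elim
    case (elim n)
    have "\<bar>?pl\<bar> * cmod l \<le> C1 * (sqrt (Q (X n)) + e n)"
      using C1(2)[OF X(1)[of n]] X(2) by (simp add: e_def pcl)
    also have "\<dots> \<le> (C1 + 1) * (sqrt (Q (X n)) + e n)"
      using Q_nonneg by (intro mult_right_mono) (auto simp: e_def)
    finally have "2 * b \<le> sqrt (Q (X n)) + e n"
      using C1(1) by (simp add: b_def field_simps)
    then have "b \<le> sqrt (Q (X n))" using elim(1) by linarith
    then have "b\<^sup>2 \<le> Q (X n)" using b Q_nonneg[of "X n"]
      by (metis less_imp_le power_mono real_sqrt_pow2)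
    then have "a * b\<^sup>2 \<le> a * Q (X n)" using a by simp
    then show ?case using lower[of n] elim(2) by linarith
  qed
  moreover have "a * b\<^sup>2 / 2 > 0" using a b by simp
  ultimately show ?thesis by blast
qed

end

text \<open>With \<open>s = (T - l0)\<^sup>-\<^sup>1 v\<close> and
  \<open>x = (T - cnj l0) v\<close>, symmetry gives
  \<open>(Gs, (T - cnj l0) v) = ((T - l0) s, Gv) = (v, Gv)\<close>. So \<open>[x,x]\<close> is the
  form at \<open>R x\<close> for the base point \<open>\<mu> = cnj l0\<close>.\<close>

lemma G0_eq:
  fixes A G :: "'a::chilbert_space lop"
  assumes A: "selfadjoint A" and G: "selfadjoint G" and adm: "admissible A G l0"
  defines "v \<equiv> \<lambda>x. resolvent (A \<bullet>\<^sub>o\<^sub>p G) (cnj l0) x"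
  shows "cinner (G0 A G l0 x) x = cinner (v x) (app G (v x))"
proof -
  let ?T = "A \<bullet>\<^sub>o\<^sub>p G"
  have l0: "l0 \<in> rho ?T" "cnj l0 \<in> rho ?T" using adm by (simp_all add: admissible_def)
  define s where "s = resolvent ?T l0 (v x)"
  have s: "s \<in> dom ?T" "app ?T s = v x + l0 *\<^sub>C s"
    using resolvent_in_dom[OF l0(1)] app_resolvent[OF l0(1)] by (simp_all add: s_def)
  have v: "v x \<in> dom ?T" "app ?T (v x) = x + cnj l0 *\<^sub>C v x"
    using resolvent_in_dom[OF l0(2)] app_resolvent[OF l0(2)] by (simp_all add: v_def)
  have "cinner (app G s) (app ?T (v x)) = cinner (app ?T s) (app G (v x))"
    using selfadjoint_cinner[OF A] s(1) v(1) by (simp add: dom_op_mult app_op_mult)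
  moreover have "cinner (app G s) (v x) = cinner s (app G (v x))"
    using selfadjoint_cinner[OF G] s(1) v(1) by (simp add: dom_op_mult)
  ultimately have "cinner (app G s) x = cinner (v x) (app G (v x))"
    unfolding s(2) v(2) by (simp add: cinner_simps)
  then show ?thesis by (simp add: G0_def s_def v_def)
qed

theorem theoremt:
  fixes A G :: "'a::chilbert_space lop"
  assumes "selfadjoint A" and "selfadjoint G" and "definitizable A G"
  shows "finite (spec (A \<bullet>\<^sub>o\<^sub>p G) - \<real>)
     \<and> (\<forall>l \<in> spec (A \<bullet>\<^sub>o\<^sub>p G) - \<real>. resolvent_pole (A \<bullet>\<^sub>o\<^sub>p G) l
            \<and> (\<forall>p. definitizing A G p \<longrightarrow> poly (map_poly complex_of_real p) l = 0))
     \<and> (\<forall>l p. l \<in> spec (A \<bullet>\<^sub>o\<^sub>p G) \<and> l \<in> \<real> \<and> l \<noteq> 0 \<and> definitizing A G p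
            \<and> poly p (Re l) > 0 \<longrightarrow> (\<forall>l0. admissible A G l0 \<longrightarrow> l \<in> sigma_pp A G l0))
     \<and> (\<forall>l p. l \<in> spec (A \<bullet>\<^sub>o\<^sub>p G) \<and> l \<in> \<real> \<and> l \<noteq> 0 \<and> definitizing A G p
            \<and> poly p (Re l) < 0 \<longrightarrow> (\<forall>l0. admissible A G l0 \<longrightarrow> l \<in> sigma_mm A G l0))"
proof -
  let ?T = "A \<bullet>\<^sub>o\<^sub>p G"
  obtain \<mu> \<nu> p0 where \<mu>: "\<mu> \<in> rho ?T" and \<nu>: "\<nu> \<in> rho (G \<bullet>\<^sub>o\<^sub>p A)" and p0: "definitizing A G p0"
    using assms(3) by (auto simp: definitizable_def)
  \<comment> \<open>Both the polynomial and the base point vary: a fixed \<open>\<mu>\<close> for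
    the spectral statements, \<open>cnj l0\<close> for the sign statements.\<close>
  have pair: "definitized_pair A G p m \<nu>" if "definitizing A G p" "m \<in> rho ?T" for p m
    using that assms \<nu> by unfold_locales
  have zero: "poly (map_poly complex_of_real p) l = 0"
    if "l \<in> spec ?T - \<real>" "definitizing A G p" for l p
    using definitized_pair.nonreal_in_rho[OF pair[OF that(2) \<mu>], of l] that(1) by (auto simp: spec_def)
  have fin: "finite (spec ?T - \<real>)"
    by (rule finite_subset[OF _ definitized_pair.finite_zeros[OF pair[OF p0 \<mu>]]]) (use zero p0 in blast)
  have pole: "resolvent_pole ?T l" if "l \<in> spec ?T - \<real>" for l
    using definitized_pair.resolvent_pole_nonreal[OF pair[OF p0 \<mu>], of l] that by simp
  have ap: "l \<in> sigma_ap ?T"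
    if "l \<in> spec ?T" "l \<in> \<real>" "definitizing A G p" "poly p (Re l) \<noteq> 0" for l p
    using definitized_pair.real_spec_sigma_ap[OF pair[OF that(3) \<mu>] that(1,2)] that(4)
      definitized_pair.pc_real[OF pair[OF that(3) \<mu>] that(2)] by simp
  have definite: "\<exists>c>0. \<forall>\<^sub>F n in sequentially. c \<le> poly p (Re l) * Re (cinner (G0 A G l0 (X n)) (X n))"
    if l: "l \<in> \<real>" "l \<noteq> 0" "definitizing A G p" "poly p (Re l) \<noteq> 0" and adm: "admissible A G l0"
      and X: "(\<forall>n. X n \<in> dom ?T \<and> norm (X n) = 1) \<and> (\<lambda>n. app ?T (X n) - l *\<^sub>C X n) \<longlonglongrightarrow> 0"
    for l p l0 X
  proof -
    have m: "cnj l0 \<in> rho ?T" "cnj l0 \<notin> \<real>"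
      using adm by (simp_all add: admissible_def complex_is_Real_iff)
    interpret definitized_pair A G p "cnj l0" \<nu> by (rule pair[OF l(3) m(1)])
    show ?thesis
      using form_definite[OF l(1,2,4) m(2), of X] X
      unfolding G0_eq[OF assms(1,2) adm] R_def by blast
  qed
  have pp: "l \<in> sigma_pp A G l0"
    if l: "l \<in> spec ?T" "l \<in> \<real>" "l \<noteq> 0" "definitizing A G p" "poly p (Re l) > 0"
      and adm: "admissible A G l0" for l p l0
    unfolding sigma_pp_def
  proof (intro CollectI conjI allI impI ap[OF l(1,2,4)])
    fix X assume X: "(\<forall>n. X n \<in> dom ?T \<and> norm (X n) = 1) \<and> (\<lambda>n. app ?T (X n) - l *\<^sub>C X n) \<longlonglongrightarrow> 0"
    obtain c where c: "c > 0"
      "\<forall>\<^sub>F n in sequentially. c \<le> poly p (Re l) * Re (cinner (G0 A G l0 (X n)) (X n))"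
      using definite[OF l(2,3,4) _ adm X] l(5) by auto
    have "0 < ereal (c / poly p (Re l))" using c(1) l(5) by simp
    also have "\<dots> \<le> liminf (\<lambda>n. ereal (Re (cinner (G0 A G l0 (X n)) (X n))))"
      by (rule Liminf_bounded, rule eventually_mono[OF c(2)]) (use l(5) in \<open>simp add: field_simps\<close>)
    finally show "0 < liminf (\<lambda>n. ereal (Re (cinner (G0 A G l0 (X n)) (X n))))" .
  qed (use l in simp)
  have mm: "l \<in> sigma_mm A G l0"
    if l: "l \<in> spec ?T" "l \<in> \<real>" "l \<noteq> 0" "definitizing A G p" "poly p (Re l) < 0"
      and adm: "admissible A G l0" for l p l0
    unfolding sigma_mm_def
  proof (intro CollectI conjI allI impI ap[OF l(1,2,4)])
    fix X assume X: "(\<forall>n. X n \<in> dom ?T \<and> norm (X n) = 1) \<and> (\<lambda>n. app ?T (X n) - l *\<^sub>C X n) \<longlonglongrightarrow> 0"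
    obtain c where c: "c > 0"
      "\<forall>\<^sub>F n in sequentially. c \<le> poly p (Re l) * Re (cinner (G0 A G l0 (X n)) (X n))"
      using definite[OF l(2,3,4) _ adm X] l(5) by auto
    \<comment> \<open>Dividing by the negative \<open>p(l)\<close> reverses the inequality, giving
      an upper bound.\<close>
    have "limsup (\<lambda>n. ereal (Re (cinner (G0 A G l0 (X n)) (X n)))) \<le> ereal (c / poly p (Re l))"
      by (rule Limsup_bounded, rule eventually_mono[OF c(2)]) (use l(5) in \<open>simp add: field_simps\<close>)
    also have "\<dots> < 0" using c(1) l(5) by (simp add: divide_less_0_iff)
    finally show "limsup (\<lambda>n. ereal (Re (cinner (G0 A G l0 (X n)) (X n)))) < 0" .
  qed (use l in simp)
  show ?thesis
    using fin pole zero pp mm by blast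
qed

end
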